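(* Let $f\colon\mathbb R/\mathbb Z\to\mathbb R/\mathbb Z$ be an orientation preserving analytic circle diffeomorphism and let $C_f\in\mathbb C/\mathbb Z$ be its welding constant. As $\omega$ tends to $+i\infty$ in $\mathbb C/\mathbb Z$ (i.e. $\operatorname{Im}\omega\to+\infty$), \[\tau_f(\omega)=\omega+C_f+o(1),\] i.e. $\tau_f(\omega)-\omega-C_f\to0$ in $\mathbb C/\mathbb Z$.
   Context: $\mathbb H^{+}=\mathbb H$ and $\mathbb H^-$ are the open upper and lower half-planes. Complex rotation number: for $\omega\in\mathbb H/\mathbb Z$ let $f_\omega=f+\omega\colon\mathbb R/\mathbb Z\to\mathbb R/\mathbb Z+\omega$. The circles $\mathbb R/\mathbb Z$ and $\mathbb R/\mathbb Z+\omega$ bound the annulus $A_\omega=\{z\in\mathbb C/\mathbb Z: 0<\operatorname{Im} z<\operatorname{Im}\omega\}$. Glueing its two boundary components via $f_\omega$ (identifying $x\in\mathbb R/\mathbb Z$ with $f(x)+\omega$) gives a complex torus $E(f_\omega)$, which is isomorphic to $\mathbb C/(\mathbb Z+\tau\mathbb Z)$ for a unique $\tau\in\mathbb H/\mathbb Z$ such that the homotopy class of $\mathbb R/\mathbb Z$ in $E(f_\omega)$ corresponds to the homotopy class of $\mathbb R/\mathbb Z$ in $\mathbb C/(\mathbb Z+\tau\mathbb Z)$. Set $\tau_f(\omega)=\tau$. Welding constant: compactify $\mathbb C/\mathbb Z$ (isomorphic to $\mathbb C\setminus\{0\}$ via $z\mapsto e^{2\pi i z}$) to a Riemann sphere $\overline{\mathbb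 C/\mathbb Z}$ by adding points $\pm i\infty$ (limits of points whose imaginary part tends to $\pm\infty$), and let $\overline{\mathbb H^\pm/\mathbb Z}=\mathbb H^\pm/\mathbb Z\cup\mathbb R/\mathbb Z\cup\{\pm i\infty\}$. Glueing $\overline{\mathbb H^+/\mathbb Z}$ to $\overline{\mathbb H^-/\mathbb Z}$ along their boundaries via $f$ (identifying $x\in\mathbb R/\mathbb Z=\partial\,\overline{\mathbb H^+/\mathbb Z}$ with $f(x)\in\mathbb R/\mathbb Z=\partial\,\overline{\mathbb H^-/\mathbb Z}$) gives a Riemann surface isomorphic to $\overline{\mathbb C/\mathbb Z}$. Choose an isomorphism $\phi$ with $\phi(\pm i\infty)=\pm i\infty$; it is unique up to addition of a constant in $\mathbb C/\mathbb Z$. It restricts to univalent maps $\phi^\pm\colon\mathbb H^\pm/\mathbb Z\to\mathbb C/\mathbb Z$ which extend univalently to neighborhoods of $\overline{\mathbb H^\pm/\mathbb Z}$ and satisfy $\phi^-\circ f=\phi^+$ near $\mathbb R/\mathbb Z$. One has $\phi^\pm(z)=z+C^\pm+o(1)$ as $z\to\pm i\infty$ for constants $C^\pm\in\mathbb C/\mathbb Z$. The welding constant is $C_f=C^+-C^-\in\mathbb C/\mathbb Z$, which depends only on $f$. *)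

theory Defs
  imports "HOL-Analysis.Analysis"
begin

section \<open>Riemann surfaces given by local parametrizations\<close>

text \<open>A surface is a set of points together with an atlas. An atlas entry \<open>(D, \<sigma>)\<close> is the inverse
  of a chart: \<open>D\<close> is open in the plane and \<open>\<sigma>\<close> is an injective parametrization of a part of the
  surface by \<open>D\<close>. The topology is the one determined by the atlas: a set is open iff all its
  preimages under the parametrizations are open. For the glued surfaces below it coincides with
  the quotient topology.\<close>

record 'a surface =
  points :: "'a set"
  params :: "(complex set \<times> (complex \<Rightarrow> 'a)) set"

definition surface_topology :: "'a surface \<Rightarrow> 'a topology" where
  "surface_topology M = topology (\<lambda>W. W \<subseteq> points M \<and>
     (\<forall>(D, \<sigma>) \<in> params M. open {z \<in> D. \<sigma> z \<in> W}))"

definition holomorphic_map :: "'a surface \<Rightarrow> 'b surface \<Rightarrow> ('a \<Rightarrow> 'b) \<Rightarrow> bool" where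
  "holomorphic_map M N h \<longleftrightarrow>
     continuous_map (surface_topology M) (surface_topology N) h \<and>
     (\<forall>(D, \<sigma>) \<in> params M. \<forall>(D', \<rho>) \<in> params N.
        (\<lambda>z. inv_into D' \<rho> (h (\<sigma> z))) holomorphic_on {z \<in> D. h (\<sigma> z) \<in> \<rho> ` D'})"

definition biholomorphic_map :: "'a surface \<Rightarrow> 'b surface \<Rightarrow> ('a \<Rightarrow> 'b) \<Rightarrow> bool" where
  "biholomorphic_map M N h \<longleftrightarrow>
     bij_betw h (points M) (points N) \<and>
     holomorphic_map M N h \<and> holomorphic_map N M (inv_into (points M) h)"

lemma openin_surface_topology:
  assumes "\<And>D \<sigma>. (D, \<sigma>) \<in> params M \<Longrightarrow> open D"
  shows "openin (surface_topology M) W \<longleftrightarrow> W \<subseteq> points M \<and>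
     (\<forall>(D, \<sigma>) \<in> params M. open {z \<in> D. \<sigma> z \<in> W})"
proof -
  let ?P = "\<lambda>W. W \<subseteq> points M \<and> (\<forall>(D, \<sigma>) \<in> params M. open {z \<in> D. \<sigma> z \<in> W})"
  have "istopology ?P"
    unfolding istopology_def
  proof (intro conjI allI impI)
    fix S T assume S: "?P S" and T: "?P T"
    show "S \<inter> T \<subseteq> points M" using S by blast
    have "{z \<in> D. \<sigma> z \<in> S \<inter> T} = {z \<in> D. \<sigma> z \<in> S} \<inter> {z \<in> D. \<sigma> z \<in> T}"
      for D and \<sigma> :: "complex \<Rightarrow> 'a" by blast
    then show "\<forall>(D, \<sigma>) \<in> params M. open {z \<in> D. \<sigma> z \<in> S \<inter> T}"
      using S T by fastforce
  next
    fix K assume K: "\<forall>S\<in>K. ?P S"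
    show "\<Union>K \<subseteq> points M" using K by blast
    have "{z \<in> D. \<sigma> z \<in> \<Union>K} = (\<Union>S\<in>K. {z \<in> D. \<sigma> z \<in> S})"
      for D and \<sigma> :: "complex \<Rightarrow> 'a" by blast
    then show "\<forall>(D, \<sigma>) \<in> params M. open {z \<in> D. \<sigma> z \<in> \<Union>K}"
      using K by fastforce
  qed
  then show ?thesis
    unfolding surface_topology_def by (simp add: topology_inverse')
qed

section \<open>The cylinder, its compactification, and complex tori\<close>

definition coset :: "complex set \<Rightarrow> complex \<Rightarrow> complex set" where
  "coset \<Gamma> z = {z + g | g. g \<in> \<Gamma>}"

definition period_lattice :: "complex \<Rightarrow> complex set" where
  "period_lattice \<tau> = {of_int m + of_int n * \<tau> | m n :: int. True}"

definition torus :: "complex \<Rightarrow> complex set surface" where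
  "torus \<tau> = \<lparr> points = range (coset (period_lattice \<tau>)),
     params = {(D, coset (period_lattice \<tau>)) | D.
       open D \<and> inj_on (coset (period_lattice \<tau>)) D} \<rparr>"

text \<open>\<open>PlusInf\<close> and \<open>MinusInf\<close> are the points \<open>+i\<infinity>\<close> and \<open>-i\<infinity>\<close>, with local coordinates
  \<open>exp(2\<pi>iz)\<close> and \<open>exp(-2\<pi>iz)\<close>, whose inverses are the following two functions.\<close>

datatype 'a with_ends = Fin 'a | PlusInf | MinusInf

definition upper_log :: "complex \<Rightarrow> complex" where
  "upper_log q = Ln q / (2 * of_real pi * \<i>)"

definition lower_log :: "complex \<Rightarrow> complex" where
  "lower_log q = - Ln q / (2 * of_real pi * \<i>)"

definition compact_cylinder :: "complex set with_ends surface" where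
  "compact_cylinder = \<lparr> points = {Fin (coset \<int> z) | z. True} \<union> {PlusInf, MinusInf},
     params = {(UNIV, \<lambda>q. if q = 0 then PlusInf else Fin (coset \<int> (upper_log q))),
               (UNIV, \<lambda>q. if q = 0 then MinusInf else Fin (coset \<int> (lower_log q)))} \<rparr>"

text \<open>Convergence to \<open>0\<close> in \<open>\<complex>/\<int>\<close>, for a function given by representatives in \<open>\<complex>\<close>.\<close>

definition tends_to_0_mod_Ints :: "('a \<Rightarrow> complex) \<Rightarrow> 'a filter \<Rightarrow> bool" where
  "tends_to_0_mod_Ints g \<F> \<longleftrightarrow> ((\<lambda>x. infdist (g x) \<int>) \<longlongrightarrow> 0) \<F>"

section \<open>Analytic circle diffeomorphisms\<close>

definition real_analytic :: "(real \<Rightarrow> real) \<Rightarrow> bool" where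
  "real_analytic F \<longleftrightarrow>
     (\<forall>x. \<exists>r>0. \<exists>a :: nat \<Rightarrow> real. \<forall>y. \<bar>y - x\<bar> < r \<longrightarrow> (\<lambda>n. a n * (y - x) ^ n) sums F y)"

text \<open>\<open>F\<close> is a lift to \<open>\<real>\<close> of an orientation preserving analytic diffeomorphism of \<open>\<real>/\<int>\<close>.\<close>

definition analytic_circle_diffeo :: "(real \<Rightarrow> real) \<Rightarrow> bool" where
  "analytic_circle_diffeo F \<longleftrightarrow>
     (\<forall>x. F (x + 1) = F x + 1) \<and> strict_mono F \<and> bij F \<and>
     real_analytic F \<and> real_analytic (inv F)"

text \<open>Parametrizations near a seam at which the boundary point \<open>P x\<close> of the upper piece is identified
  with the boundary point \<open>Q (F x)\<close> of the lower piece: \<open>G\<close> is a holomorphic extension of \<open>F\<close>, the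
  part of \<open>D\<close> above the real axis is sent to the upper piece by \<open>P\<close> and the part below it is sent
  to the lower piece by \<open>Q \<circ> G\<close>. The sets \<open>A\<close> and \<open>B\<close> are the domains of \<open>P\<close> and \<open>Q\<close>.\<close>

definition seam_params ::
  "(real \<Rightarrow> real) \<Rightarrow> complex set \<Rightarrow> (complex \<Rightarrow> 'a) \<Rightarrow> complex set \<Rightarrow> (complex \<Rightarrow> 'a) \<Rightarrow>
   (complex set \<times> (complex \<Rightarrow> 'a)) set" where
  "seam_params F A P B Q = {(D, \<sigma>). open D \<and> inj_on \<sigma> D \<and>
     (\<exists>G. G holomorphic_on D \<and>
          (\<forall>x. of_real x \<in> D \<longrightarrow> G (of_real x) = of_real (F x)) \<and>
          (\<forall>z\<in>D. if 0 \<le> Im z then z \<in> A else G z \<in> B) \<and>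
          \<sigma> = (\<lambda>z. if 0 \<le> Im z then P z else Q (G z)))}"

lemma circle_lift_Ints:
  assumes "analytic_circle_diffeo F"
  shows "of_real (F x) - of_real (F y) \<in> (\<int> :: complex set) \<longleftrightarrow>
         of_real x - of_real y \<in> (\<int> :: complex set)"
proof -
  have per: "F (x + 1) = F x + 1" for x
    using assms by (simp add: analytic_circle_diffeo_def)
  have inj: "inj F"
    using assms by (simp add: analytic_circle_diffeo_def bij_is_inj)
  have pern: "F (x + real n) = F x + real n" for x n
    by (induction n) (auto simp: per add.assoc[symmetric] add.commute[of 1])
  have peri: "F (x + of_int k) = F x + of_int k" for x k
  proof (cases "k \<ge> 0")
    case True
    then show ?thesis using pern[of x "nat k"] by simp
  next
    case False
    then show ?thesis using pern[of "x + of_int k" "nat (- k)"] by simp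
  qed
  have "F x - F y \<in> \<int> \<longleftrightarrow> x - y \<in> \<int>"
  proof
    assume "F x - F y \<in> \<int>"
    then obtain k where "F x - F y = of_int k" by (auto elim: Ints_cases)
    then have "F x = F (y + of_int k)" by (simp add: peri)
    then have "x = y + of_int k" using inj by (simp add: inj_eq)
    then show "x - y \<in> \<int>" by simp
  next
    assume "x - y \<in> \<int>"
    then obtain k where "x - y = of_int k" by (auto elim: Ints_cases)
    then have "x = y + of_int k" by simp
    then show "F x - F y \<in> \<int>" by (simp add: peri)
  qed
  then show ?thesis
    by (simp flip: of_real_diff)
qed

section \<open>The complex rotation number\<close>

definition closed_strip :: "complex \<Rightarrow> complex set" where
  "closed_strip \<omega> = {z. 0 \<le> Im z \<and> Im z \<le> Im \<omega>}"

text \<open>The points of the glued annulus are the classes of the closed strip under integer translations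
  and the identification of \<open>x\<close> with \<open>F x + \<omega>\<close> for real \<open>x\<close>.\<close>

definition annulus_rel :: "(real \<Rightarrow> real) \<Rightarrow> complex \<Rightarrow> (complex \<times> complex) set" where
  "annulus_rel F \<omega> = {(z, w). z \<in> closed_strip \<omega> \<and> w \<in> closed_strip \<omega> \<and>
     (z - w \<in> \<int> \<or>
      Im z = 0 \<and> w - (of_real (F (Re z)) + \<omega>) \<in> \<int> \<or>
      Im w = 0 \<and> z - (of_real (F (Re w)) + \<omega>) \<in> \<int>)}"

definition annulus_class :: "(real \<Rightarrow> real) \<Rightarrow> complex \<Rightarrow> complex \<Rightarrow> complex set" where
  "annulus_class F \<omega> z = annulus_rel F \<omega> `` {z}"

definition glued_annulus :: "(real \<Rightarrow> real) \<Rightarrow> complex \<Rightarrow> complex set surface" where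
  "glued_annulus F \<omega> = \<lparr> points = closed_strip \<omega> // annulus_rel F \<omega>,
     params =
       {(D, annulus_class F \<omega>) | D. open D \<and> D \<subseteq> {z. 0 < Im z \<and> Im z < Im \<omega>} \<and>
          inj_on (annulus_class F \<omega>) D} \<union>
       seam_params F {z. 0 \<le> Im z \<and> Im z < Im \<omega>} (annulus_class F \<omega>)
         {z. - Im \<omega> < Im z \<and> Im z < 0} (\<lambda>z. annulus_class F \<omega> (z + \<omega>)) \<rparr>"

text \<open>\<open>\<tau>\<close> represents the complex rotation number of \<open>f + \<omega>\<close> in \<open>\<complex>/\<int>\<close>. The homotopy is a free
  homotopy of loops, from the image of the circle \<open>\<real>/\<int>\<close> under the isomorphism to the circle
  \<open>\<real>/\<int>\<close> in the torus.\<close>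

definition has_complex_rotation_number :: "(real \<Rightarrow> real) \<Rightarrow> complex \<Rightarrow> complex \<Rightarrow> bool" where
  "has_complex_rotation_number F \<omega> \<tau> \<longleftrightarrow> 0 < Im \<tau> \<and>
     (\<exists>h. biholomorphic_map (glued_annulus F \<omega>) (torus \<tau>) h \<and>
        homotopic_with (\<lambda>\<gamma>. \<gamma> 0 = \<gamma> 1) (top_of_set {0..1 :: real}) (surface_topology (torus \<tau>))
          (\<lambda>t. h (annulus_class F \<omega> (of_real t)))
          (\<lambda>t. coset (period_lattice \<tau>) (of_real t)))"

lemma equiv_annulus_rel:
  assumes F: "analytic_circle_diffeo F" and \<omega>: "0 < Im \<omega>"
  shows "equiv (closed_strip \<omega>) (annulus_rel F \<omega>)"
proof (rule equivI)
  show "annulus_rel F \<omega> \<subseteq> closed_strip \<omega> \<times> closed_strip \<omega>"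
    by (auto simp: annulus_rel_def)
  show "refl_on (closed_strip \<omega>) (annulus_rel F \<omega>)"
    by (auto simp: refl_on_def annulus_rel_def)
  have minus: "a - b \<in> \<int> \<Longrightarrow> b - a \<in> \<int>" for a b :: complex
    by (metis Ints_minus minus_diff_eq)
  show "sym (annulus_rel F \<omega>)"
    unfolding sym_def annulus_rel_def by (auto dest: minus)
  have tr: "a - b \<in> \<int> \<Longrightarrow> b - c \<in> \<int> \<Longrightarrow> a - c \<in> \<int>" for a b c :: complex
    by (metis Ints_add diff_add_cancel add_diff_eq)
  have Im: "Im a = Im b" if "a - b \<in> \<int>" for a b :: complex
    using that by (metis Ints_cases Im_complex_of_real complex_eq_iff
        diff_add_cancel plus_complex.sel(2) add_0 of_real_of_int_eq)
  have FI: "of_real (F (Re a)) - of_real (F (Re b)) \<in> (\<int> :: complex set) \<longleftrightarrow> a - b \<in> \<int>"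
    if "Im a = 0" "Im b = 0" for a b
  proof -
    have "of_real (Re a) = a" "of_real (Re b) = b"
      using that by (simp_all add: complex_eq_iff)
    then show ?thesis using circle_lift_Ints[OF F, of "Re a" "Re b"] by simp
  qed
  define Z where "Z a = of_real (F (Re a)) + \<omega>" for a
  have Z: "Z a - Z b \<in> \<int> \<longleftrightarrow> a - b \<in> \<int>" if "Im a = 0" "Im b = 0" for a b
    using FI[OF that] by (simp add: Z_def)
  have ImZ: "Im (Z a) = Im \<omega>" for a by (simp add: Z_def)
  have rel: "(a, b) \<in> annulus_rel F \<omega> \<longleftrightarrow> a \<in> closed_strip \<omega> \<and> b \<in> closed_strip \<omega> \<and>
     (a - b \<in> \<int> \<or> Im a = 0 \<and> b - Z a \<in> \<int> \<or> Im b = 0 \<and> a - Z b \<in> \<int>)" for a b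
    by (simp add: annulus_rel_def Z_def)
  show "trans (annulus_rel F \<omega>)"
  proof (rule transI)
    fix a b c assume ab: "(a, b) \<in> annulus_rel F \<omega>" and bc: "(b, c) \<in> annulus_rel F \<omega>"
    have mem: "a \<in> closed_strip \<omega>" "c \<in> closed_strip \<omega>" using ab bc rel by blast+
    have ab': "a - b \<in> \<int> \<or> Im a = 0 \<and> b - Z a \<in> \<int> \<or> Im b = 0 \<and> a - Z b \<in> \<int>"
      and bc': "b - c \<in> \<int> \<or> Im b = 0 \<and> c - Z b \<in> \<int> \<or> Im c = 0 \<and> b - Z c \<in> \<int>"
      using ab bc rel by blast+
    have "a - c \<in> \<int> \<or> Im a = 0 \<and> c - Z a \<in> \<int> \<or> Im c = 0 \<and> a - Z c \<in> \<int>"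
      using ab'
    proof (elim disjE conjE)
      assume 1: "a - b \<in> \<int>"
      show ?thesis using bc'
      proof (elim disjE conjE)
        assume "b - c \<in> \<int>" then show ?thesis using 1 tr by blast
      next
        assume 2: "Im b = 0" "c - Z b \<in> \<int>"
        then have "Im a = 0" using Im[OF 1] by simp
        then show ?thesis using 1 2 tr minus Z by metis
      next
        assume "Im c = 0" "b - Z c \<in> \<int>" then show ?thesis using 1 tr by blast
      qed
    next
      assume 1: "Im a = 0" "b - Z a \<in> \<int>"
      then have b: "Im b = Im \<omega>" using Im ImZ by metis
      show ?thesis using bc'
      proof (elim disjE conjE)
        assume "b - c \<in> \<int>" then show ?thesis using 1 tr minus by blast
      next
        assume "Im b = 0" then show ?thesis using b \<omega> by simp
      next
        assume "Im c = 0" "b - Z c \<in> \<int>"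
        then show ?thesis using 1 tr minus Z by metis
      qed
    next
      assume 1: "Im b = 0" "a - Z b \<in> \<int>"
      show ?thesis using bc'
      proof (elim disjE conjE)
        assume 2: "b - c \<in> \<int>"
        then have "Im c = 0" using Im 1 by metis
        then show ?thesis using 1 2 tr Z by metis
      next
        assume "Im b = 0" "c - Z b \<in> \<int>" then show ?thesis using 1 tr minus by blast
      next
        assume "Im c = 0" "b - Z c \<in> \<int>"
        then have "Im b = Im \<omega>" using Im ImZ by metis
        then show ?thesis using 1 \<omega> by simp
      qed
    qed
    then show "(a, c) \<in> annulus_rel F \<omega>" using mem rel by blast
  qed
qed

section \<open>The welding constant\<close>

text \<open>\<open>Inl z\<close> is the class of \<open>z\<close> in the closed upper half-cylinder, \<open>Inr w\<close> that of \<open>w\<close> in the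
  closed lower one; \<open>Inl x\<close> is identified with \<open>Inr (F x)\<close> for real \<open>x\<close>.\<close>

definition closed_half_planes :: "(complex + complex) set" where
  "closed_half_planes = {z. 0 \<le> Im z} <+> {w. Im w \<le> 0}"

fun weld_identified :: "(real \<Rightarrow> real) \<Rightarrow> complex + complex \<Rightarrow> complex + complex \<Rightarrow> bool" where
  "weld_identified F (Inl z) (Inl z') \<longleftrightarrow> z - z' \<in> \<int>"
| "weld_identified F (Inr w) (Inr w') \<longleftrightarrow> w - w' \<in> \<int>"
| "weld_identified F (Inl z) (Inr w) \<longleftrightarrow> Im z = 0 \<and> w - of_real (F (Re z)) \<in> \<int>"
| "weld_identified F (Inr w) (Inl z) \<longleftrightarrow> Im z = 0 \<and> w - of_real (F (Re z)) \<in> \<int>"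

definition weld_rel ::
  "(real \<Rightarrow> real) \<Rightarrow> ((complex + complex) \<times> (complex + complex)) set" where
  "weld_rel F = {(p, q). p \<in> closed_half_planes \<and> q \<in> closed_half_planes \<and> weld_identified F p q}"

definition weld_upper :: "(real \<Rightarrow> real) \<Rightarrow> complex \<Rightarrow> (complex + complex) set with_ends" where
  "weld_upper F z = Fin (weld_rel F `` {Inl z})"

definition weld_lower :: "(real \<Rightarrow> real) \<Rightarrow> complex \<Rightarrow> (complex + complex) set with_ends" where
  "weld_lower F w = Fin (weld_rel F `` {Inr w})"

definition welded_sphere :: "(real \<Rightarrow> real) \<Rightarrow> (complex + complex) set with_ends surface" where
  "welded_sphere F = \<lparr> points = Fin ` (closed_half_planes // weld_rel F) \<union> {PlusInf, MinusInf},
     params =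
       {(D, weld_upper F) | D. open D \<and> D \<subseteq> {z. 0 < Im z} \<and> inj_on (weld_upper F) D} \<union>
       {(D, weld_lower F) | D. open D \<and> D \<subseteq> {w. Im w < 0} \<and> inj_on (weld_lower F) D} \<union>
       seam_params F {z. 0 \<le> Im z} (weld_upper F) {w. Im w < 0} (weld_lower F) \<union>
       {(ball 0 1, \<lambda>q. if q = 0 then PlusInf else weld_upper F (upper_log q)),
        (ball 0 1, \<lambda>q. if q = 0 then MinusInf else weld_lower F (lower_log q))} \<rparr>"

text \<open>\<open>\<phi>p\<close> and \<open>\<phi>m\<close> choose representatives in \<open>\<complex>\<close> of the values of the restrictions of the
  isomorphism to the two open half-cylinders; \<open>C\<close> represents the welding constant in \<open>\<complex>/\<int>\<close>.\<close>

definition has_welding_constant :: "(real \<Rightarrow> real) \<Rightarrow> complex \<Rightarrow> bool" where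
  "has_welding_constant F C \<longleftrightarrow>
     (\<exists>\<phi> \<phi>p \<phi>m Cp Cm.
        biholomorphic_map (welded_sphere F) compact_cylinder \<phi> \<and>
        \<phi> PlusInf = PlusInf \<and> \<phi> MinusInf = MinusInf \<and>
        (\<forall>z. 0 < Im z \<longrightarrow> \<phi> (weld_upper F z) = Fin (coset \<int> (\<phi>p z))) \<and>
        (\<forall>w. Im w < 0 \<longrightarrow> \<phi> (weld_lower F w) = Fin (coset \<int> (\<phi>m w))) \<and>
        tends_to_0_mod_Ints (\<lambda>z. \<phi>p z - z - Cp) (filtercomap Im at_top) \<and>
        tends_to_0_mod_Ints (\<lambda>w. \<phi>m w - w - Cm) (filtercomap Im at_bot) \<and>
        C - (Cp - Cm) \<in> \<int>)"

lemma equiv_weld_rel: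
  assumes F: "analytic_circle_diffeo F"
  shows "equiv closed_half_planes (weld_rel F)"
proof (rule equivI)
  show "weld_rel F \<subseteq> closed_half_planes \<times> closed_half_planes"
    by (auto simp: weld_rel_def)
  have "weld_identified F p p" for p by (cases p) auto
  then show "refl_on closed_half_planes (weld_rel F)"
    by (auto simp: refl_on_def weld_rel_def)
  have minus: "a - b \<in> \<int> \<Longrightarrow> b - a \<in> \<int>" for a b :: complex
    by (metis Ints_minus minus_diff_eq)
  have "weld_identified F p q \<Longrightarrow> weld_identified F q p" for p q
    by (cases p; cases q) (auto dest: minus)
  then show "sym (weld_rel F)"
    unfolding sym_def weld_rel_def by auto
  have tr: "a - b \<in> \<int> \<Longrightarrow> b - c \<in> \<int> \<Longrightarrow> a - c \<in> \<int>" for a b c :: complex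
    by (metis Ints_add diff_add_cancel add_diff_eq)
  have Im: "Im a = Im b" if "a - b \<in> \<int>" for a b :: complex
    using that by (metis Ints_cases Im_complex_of_real complex_eq_iff
        diff_add_cancel plus_complex.sel(2) add_0 of_real_of_int_eq)
  define Z where "Z a = complex_of_real (F (Re a))" for a
  have Z: "Z a - Z b \<in> \<int> \<longleftrightarrow> a - b \<in> \<int>" if "Im a = 0" "Im b = 0" for a b
  proof -
    have "of_real (Re a) = a" "of_real (Re b) = b"
      using that by (simp_all add: complex_eq_iff)
    then show ?thesis using circle_lift_Ints[OF F, of "Re a" "Re b"] by (simp add: Z_def)
  qed
  have "weld_identified F p r" if "weld_identified F p q" "weld_identified F q r" for p q r
    using that
    by (cases p; cases q; cases r; simp flip: Z_def) (metis tr minus Z Im)+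
  then show "trans (weld_rel F)"
    unfolding trans_def weld_rel_def by blast
qed

end

theory Submission
  imports Defs "HOL-Complex_Analysis.Complex_Analysis"
begin

text \<open>Let \<open>\<Phi>p\<close> and \<open>\<Phi>m\<close> be the lifts to the upper and the lower half-plane of the welding isomorphism,
  and \<open>H\<close> the lift to the strip \<open>0 < Im z < Im \<omega>\<close> of the isomorphism from the glued annulus to its torus.
  Continue \<open>\<Phi>p\<close> and \<open>H\<close> a little below the real axis by means of a holomorphic extension \<open>G\<close> of \<open>F\<close>.
  Then \<open>\<Phi>m (G z) = \<Phi>p z\<close> and \<open>H (G z + \<omega>) = H z + g\<close> with a constant \<open>g\<close>, and all three functions
  commute with \<open>z \<mapsto> z + 1\<close> (lemmas \<open>welding_maps\<close> and \<open>torus_coordinate\<close>). So the \<open>1\<close>-periodic forms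
  \<open>(H - \<Phi>p) d\<Phi>p\<close> above the seam and \<open>(H(\<cdot> + \<omega>) - g - \<Phi>m) d\<Phi>m\<close> below it correspond to each other
  under \<open>G\<close>, and their integrals over a period agree. As each of these integrals can be computed at any
  height, both can be moved to the line \<open>Im z = Im \<omega> / 2\<close>, the second one after the shift by \<open>\<omega>\<close>.
  The result is the identity

    \<open>g = \<Phi>p z - \<Phi>m (z - \<omega>) - \<integral> (H - c) d(\<Phi>p - \<Phi>m(\<cdot> - \<omega>))\<close>,

  with integration from \<open>z\<close> to \<open>z + 1\<close> and an arbitrary constant \<open>c\<close> (lemma \<open>gluing_period_defect\<close>).

  Far from the seam, \<open>\<Phi>p z = z + A + o(1)\<close> and \<open>\<Phi>m z = z + B + o(1)\<close> with \<open>A - B\<close> congruent to \<open>C\<close>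
  modulo \<open>\<int>\<close>, and by Cauchy's inequality both derivatives tend to \<open>1\<close>. The
  factor \<open>H - c\<close> is bounded by an absolute constant: \<open>H\<close> is injective modulo \<open>\<int>\<close>, so \<open>H - H z0\<close> omits \<open>1\<close>
  and \<open>-1\<close> in the disc of radius \<open>1\<close> about \<open>z0\<close>, and Schottky's theorem applies (lemma
  \<open>oscillation_bound\<close>). So \<open>g = \<omega> + A - B + o(1)\<close> (lemma \<open>gluing_period_estimate\<close>), and in particular
  \<open>Im g > 0\<close> eventually. Finally \<open>g\<close> represents \<open>\<tau> \<omega>\<close> modulo \<open>\<int>\<close>: it is a period of the torus, it generates
  the lattice together with \<open>1\<close>, and the sign is fixed by \<open>Im g > 0\<close> (lemma \<open>index_one\<close>).\<close>

section \<open>Strips and functions with discrete values\<close>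

definition strip :: "real \<Rightarrow> real \<Rightarrow> complex set" where
  "strip a b = {z. a < Im z \<and> Im z < b}"

lemma mem_strip [simp]: "z \<in> strip a b \<longleftrightarrow> a < Im z \<and> Im z < b"
  by (simp add: strip_def)

lemma open_strip: "open (strip a b)"
  unfolding strip_def by (intro open_Collect_conj open_halfspace_Im_gt open_halfspace_Im_lt)

lemma convex_strip: "convex (strip a b)"
proof -
  have "strip a b = {z. Im z > a} \<inter> {z. Im z < b}" by (auto simp: strip_def)
  then show ?thesis by (simp add: convex_Int convex_halfspace_Im_gt convex_halfspace_Im_lt)
qed

text \<open>Two lifts of one map differ by a function with values in a lattice. This makes such a
  difference constant; the separation \<open>e\<close> is \<open>1\<close> for \<open>\<int>\<close> and \<open>min 1 (Im \<tau>)\<close> for \<open>\<int> + \<tau>\<int>\<close>.\<close>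

lemma discrete_valued_constant:
  fixes f :: "'a::topological_space \<Rightarrow> complex"
  assumes "connected S" "continuous_on S f" "f ` S \<subseteq> \<Gamma>" "0 < e"
    and sep: "\<And>x y. x \<in> \<Gamma> \<Longrightarrow> y \<in> \<Gamma> \<Longrightarrow> x \<noteq> y \<Longrightarrow> e \<le> norm (x - y)"
  shows "\<exists>c. \<forall>x\<in>S. f x = c"
proof -
  have "f constant_on S"
  proof (rule continuous_discrete_range_constant[OF assms(1,2)])
    fix x assume "x \<in> S"
    then have "\<forall>y. y \<in> S \<and> f y \<noteq> f x \<longrightarrow> e \<le> norm (f y - f x)"
      using sep assms(3) by blast
    then show "\<exists>e>0. \<forall>y. y \<in> S \<and> f y \<noteq> f x \<longrightarrow> e \<le> norm (f y - f x)"
      using \<open>0 < e\<close> by blast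
  qed
  then show ?thesis by (auto simp: constant_on_def)
qed

lemma dist_Ints_ge_1:
  assumes "x \<in> \<int>" "y \<in> \<int>" "x \<noteq> y"
  shows "1 \<le> norm (x - y :: complex)"
proof -
  obtain m n where "x = of_int m" "y = of_int n" using assms by (auto elim!: Ints_cases)
  then have "norm (x - y) = \<bar>of_int (m - n)\<bar>" "m \<noteq> n"
    using assms(3) by (auto simp flip: of_int_diff simp del: of_int_abs)
  then show ?thesis by linarith
qed

lemma Ints_valued_constant:
  fixes f :: "'a::topological_space \<Rightarrow> complex"
  assumes "connected S" "continuous_on S f" "\<And>x. x \<in> S \<Longrightarrow> f x \<in> \<int>" 
  shows "\<exists>c. \<forall>x\<in>S. f x = c"
  by (rule discrete_valued_constant[OF assms(1,2), of \<int> 1])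
    (use assms(3) dist_Ints_ge_1 in auto)

lemma equal_derivatives_imp_constant_difference:
  assumes "convex U" "open U"
    and "\<And>z. z \<in> U \<Longrightarrow> (f has_field_derivative f' z) (at z)"
    and "\<And>z. z \<in> U \<Longrightarrow> (g has_field_derivative f' z) (at z)"
    and "z \<in> U" "w \<in> U"
  shows "f z - g z = f w - (g w :: complex)"
proof -
  have "\<exists>c. \<forall>z\<in>U. f z - g z = c"
  proof (rule has_field_derivative_zero_constant[OF assms(1)])
    fix z assume "z \<in> U"
    then show "((\<lambda>z. f z - g z) has_field_derivative 0) (at z within U)"
      using DERIV_diff[OF assms(3,4)] has_field_derivative_at_within by fastforce
  qed
  then show ?thesis using assms(5,6) by metis
qed

text \<open>The integral of a \<open>1\<close>-periodic holomorphic function from \<open>z\<close> to \<open>z + 1\<close> does not depend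
  on \<open>z\<close>. Such integrals are expressed by primitives throughout, which avoids path integrals.\<close>

lemma period_of_primitive_constant:
  assumes "convex U" "open U" and tr: "\<And>z. z \<in> U \<Longrightarrow> z + 1 \<in> U"
    and P: "\<And>z. z \<in> U \<Longrightarrow> (P has_field_derivative p z) (at z)"
    and per: "\<And>z. z \<in> U \<Longrightarrow> p (z + 1) = p z"
    and "z \<in> U" "w \<in> U"
  shows "P (z + 1) - P z = P (w + 1) - (P w :: complex)"
proof (rule equal_derivatives_imp_constant_difference[where f = "\<lambda>z. P (z + 1)" and f' = p])
  fix z assume "z \<in> U"
  then have "(P has_field_derivative p z) (at (z + 1))" using P[OF tr] per by simp
  then show "((\<lambda>z. P (z + 1)) has_field_derivative p z) (at z)"
    by (simp add: DERIV_shift)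
qed (use assms in auto)

lemma deriv_periodic:
  assumes "open U" "f holomorphic_on U" "z \<in> U" "z + 1 \<in> U"
    and "\<And>z. z \<in> U \<Longrightarrow> f (z + 1) = f z + (1::complex)"
  shows "deriv f (z + 1) = deriv f z"
proof -
  have "(f has_field_derivative deriv f (z + 1)) (at (z + 1))"
    using assms holomorphic_derivI by blast
  then have "((\<lambda>z. f (z + 1) - 1) has_field_derivative deriv f (z + 1)) (at z)"
    using DERIV_shift by (intro derivative_eq_intros) auto
  then have "(f has_field_derivative deriv f (z + 1)) (at z)"
    by (rule has_field_derivative_transform_within_open[OF _ assms(1,3)]) (use assms in auto)
  then show ?thesis using DERIV_imp_deriv by metis
qed

lemma primitive_on_strip:
  assumes "f holomorphic_on strip a b"
  obtains P where "\<And>z. z \<in> strip a b \<Longrightarrow> (P has_field_derivative f z) (at z)"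
  using holomorphic_convex_primitive'[OF convex_strip open_strip assms]
    at_within_open[OF _ open_strip] by metis

section \<open>The period of a glued coordinate\<close>

text \<open>In the coordinates \<open>\<Phi>p\<close> and \<open>\<Phi>m\<close> of the two sides, the seam is invisible: \<open>\<Phi>m \<circ> G = \<Phi>p\<close>. The
  function \<open>H\<close> is a coordinate on the strip whose values on the two sides differ by \<open>g\<close>. Hence the
  form \<open>(H - \<Phi>p) d\<Phi>p\<close> is the pullback under \<open>G\<close> of the form \<open>(H(\<cdot> + \<omega>) - g - \<Phi>m) d\<Phi>m\<close>, and both
  have the same period under \<open>z \<mapsto> z + 1\<close>. Since \<open>\<Phi> d\<Phi>\<close> and \<open>d\<Phi>\<close> have the elementary primitives
  \<open>\<Phi>\<^sup>2 / 2\<close> and \<open>\<Phi>\<close>, equality of the periods is an exact formula for \<open>g\<close>, in which the only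
  unknown is the integral of \<open>(H - c) d(\<Phi>p - \<Phi>m(\<cdot> - \<omega>))\<close>, that is, an increment of \<open>R\<close>.\<close>

lemma gluing_period_defect:
  fixes H \<Phi>p \<Phi>m G :: "complex \<Rightarrow> complex"
  assumes e: "0 < e"
    and om: "1 \<le> Im \<omega>"
    and H: "H holomorphic_on strip (-e) (Im \<omega>)"
    and p: "\<Phi>p holomorphic_on {z. -e < Im z}"
    and m: "\<Phi>m holomorphic_on {z. Im z < 0}"
    and G: "G holomorphic_on strip (-e) e"
    and G_lower: "\<And>z. z \<in> strip (-e) 0 \<Longrightarrow> G z \<in> strip (-1) 0"
    and H1: "\<And>z. z \<in> strip (-e) (Im \<omega>) \<Longrightarrow> H (z + 1) = H z + 1"
    and p1: "\<And>z. -e < Im z \<Longrightarrow> \<Phi>p (z + 1) = \<Phi>p z + 1"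
    and m1: "\<And>z. Im z < 0 \<Longrightarrow> \<Phi>m (z + 1) = \<Phi>m z + 1"
    and G1: "\<And>z. z \<in> strip (-e) e \<Longrightarrow> G (z + 1) = G z + 1"
    and pm: "\<And>z. z \<in> strip (-e) 0 \<Longrightarrow> \<Phi>m (G z) = \<Phi>p z"
    and Hg: "\<And>z. z \<in> strip (-e) 0 \<Longrightarrow> H (G z + \<omega>) = H z + g"
  obtains R where 
    "\<And>z. z \<in> strip 0 (Im \<omega>) \<Longrightarrow>
       (R has_field_derivative (H z - c) * (deriv \<Phi>p z - deriv \<Phi>m (z - \<omega>))) (at z)"
    "\<And>z. z \<in> strip 0 (Im \<omega>) \<Longrightarrow> R (z + 1) - R z = \<Phi>p z - \<Phi>m (z - \<omega>) - g"
proof -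
  define U where "U = strip (-e) (Im \<omega>)"
  define V where "V = strip (- Im \<omega>) 0"
  define N where "N = strip (-e) 0"
  have dp: "(\<Phi>p has_field_derivative deriv \<Phi>p z) (at z)" if "-e < Im z" for z
    using holomorphic_derivI[OF p open_halfspace_Im_gt] that by simp
  have dm: "(\<Phi>m has_field_derivative deriv \<Phi>m z) (at z)" if "Im z < 0" for z
    using holomorphic_derivI[OF m open_halfspace_Im_lt] that by simp
  have dG: "(G has_field_derivative deriv G z) (at z)" if "z \<in> strip (-e) e" for z
    using holomorphic_derivI[OF G open_strip that] .
  define p' where "p' z = (H z - \<Phi>p z) * deriv \<Phi>p z" for z
  define q' where "q' w = (H (w + \<omega>) - g - \<Phi>m w) * deriv \<Phi>m w" for w
  have "p' holomorphic_on U"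
    unfolding p'_def U_def
    by (intro holomorphic_intros H holomorphic_on_subset[OF p]
        holomorphic_on_subset[OF holomorphic_deriv[OF p open_halfspace_Im_gt]]) auto
  then obtain P where P: "\<And>z. z \<in> U \<Longrightarrow> (P has_field_derivative p' z) (at z)"
    unfolding U_def using primitive_on_strip by blast
  have "(H \<circ> (\<lambda>w. w + \<omega>)) holomorphic_on V"
    by (intro holomorphic_on_compose_gen[OF _ H] holomorphic_intros) (use e in \<open>auto simp: V_def\<close>)
  then have "q' holomorphic_on V"
    unfolding q'_def o_def V_def
    by (intro holomorphic_intros holomorphic_on_subset[OF m]
        holomorphic_on_subset[OF holomorphic_deriv[OF m open_halfspace_Im_lt]]) auto
  then obtain Q where Q: "\<And>z. z \<in> V \<Longrightarrow> (Q has_field_derivative q' z) (at z)"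
    unfolding V_def using primitive_on_strip by blast
  have GV: "G z \<in> V" if "z \<in> N" for z
    using G_lower[of z] that om by (auto simp: V_def N_def)
  have QG: "((\<lambda>z. Q (G z)) has_field_derivative p' z) (at z)" if z: "z \<in> N" for z
  proof -
    have dGz: "(G has_field_derivative deriv G z) (at z)" using dG that e by (auto simp: N_def)
    have "((\<lambda>z. \<Phi>m (G z)) has_field_derivative deriv \<Phi>m (G z) * deriv G z) (at z)"
      using GV[OF z] by (intro DERIV_chain2[OF dm dGz]) (auto simp: V_def)
    then have "(\<Phi>p has_field_derivative deriv \<Phi>m (G z) * deriv G z) (at z)"
      by (rule has_field_derivative_transform_within_open[OF _ open_strip z[unfolded N_def]]) (simp add: pm)
    then have "deriv \<Phi>p z = deriv \<Phi>m (G z) * deriv G z" by (rule DERIV_imp_deriv)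
    then have "q' (G z) * deriv G z = p' z"
      using z by (simp add: q'_def p'_def Hg pm N_def)
    then show ?thesis using DERIV_chain2[OF Q[OF GV[OF z]] dGz] by simp
  qed
  have p'1: "p' (z + 1) = p' z" if "z \<in> U" for z
    using that H1[of z] p1[of z] deriv_periodic[OF open_halfspace_Im_gt p, of z] p1
    by (simp add: p'_def U_def)
  have q'1: "q' (z + 1) = q' z" if "z \<in> V" for z
    using that H1[of "z + \<omega>"] m1[of z] deriv_periodic[OF open_halfspace_Im_lt m, of z] m1 e
    by (simp add: q'_def V_def add.commute add.left_commute)
  \<comment> \<open>The two forms agree across the seam, so their periods agree.\<close>
  define a where "a = - (of_real e / 2) * \<i>"
  have aN: "a \<in> N" "a + 1 \<in> N" using e by (auto simp: a_def N_def)
  have aU: "a \<in> U" using e om by (auto simp: a_def U_def)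
  have "Q (G (a + 1)) - P (a + 1) = Q (G a) - P a"
  proof (rule equal_derivatives_imp_constant_difference[OF convex_strip open_strip])
    show "a + 1 \<in> strip (-e) 0" "a \<in> strip (-e) 0" using aN by (auto simp: N_def)
    fix z assume "z \<in> strip (-e) 0"
    then have "z \<in> N" "z \<in> U" using om by (auto simp: N_def U_def)
    then show "((\<lambda>z. Q (G z)) has_field_derivative p' z) (at z)"
      "(P has_field_derivative p' z) (at z)" using QG P by auto
  qed
  moreover have "G (a + 1) = G a + 1" using G1[of a] aN e by (auto simp: N_def)
  ultimately have PQa: "P (a + 1) - P a = Q (G a + 1) - Q (G a)" by (simp add: algebra_simps)
  have PQ: "P (z + 1) - P z = Q (w + 1) - Q w" if "z \<in> U" "w \<in> V" for z w
  proof -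
    have "P (z + 1) - P z = P (a + 1) - P a"
      using period_of_primitive_constant[OF convex_strip open_strip, of "-e" "Im \<omega>" P p' z a]
        P p'1 that(1) aU by (simp add: U_def)
    moreover have "Q (w + 1) - Q w = Q (G a + 1) - Q (G a)"
      using period_of_primitive_constant[OF convex_strip open_strip, of "- Im \<omega>" 0 Q q' w "G a"]
        Q q'1 that(2) GV[OF aN(1)] by (simp add: V_def)
    ultimately show ?thesis using PQa by simp
  qed
  \<comment> \<open>The added terms turn the two forms into \<open>(H - c) d\<Phi>p\<close> and \<open>(H - c) d\<Phi>m(\<cdot> - \<omega>)\<close>.\<close>
  define R where "R z = P z - Q (z - \<omega>) + ((\<Phi>p z)\<^sup>2 / 2 - c * \<Phi>p z)
      - ((\<Phi>m (z - \<omega>))\<^sup>2 / 2 + (g - c) * \<Phi>m (z - \<omega>))" for z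
  show thesis
  proof (rule that[of R])
    fix z assume z: "z \<in> strip 0 (Im \<omega>)"
    have zU: "z \<in> U" and zV: "z - \<omega> \<in> V" using z e by (auto simp: U_def V_def)
    have Qs: "((\<lambda>z. Q (z - \<omega>)) has_field_derivative q' (z - \<omega>)) (at z)"
      using Q[OF zV] DERIV_shift[of Q "q' (z - \<omega>)" z "- \<omega>"] by simp
    have ms: "((\<lambda>z. \<Phi>m (z - \<omega>)) has_field_derivative deriv \<Phi>m (z - \<omega>)) (at z)"
      using dm[of "z - \<omega>"] zV DERIV_shift[of \<Phi>m "deriv \<Phi>m (z - \<omega>)" z "- \<omega>"]
      by (simp add: V_def)
    have ps: "(\<Phi>p has_field_derivative deriv \<Phi>p z) (at z)" using dp z e by auto
    show "(R has_field_derivative (H z - c) * (deriv \<Phi>p z - deriv \<Phi>m (z - \<omega>))) (at z)"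
      unfolding R_def
      by (auto intro!: derivative_eq_intros P[OF zU] Qs ms ps
          simp: p'_def q'_def algebra_simps)
    have "\<Phi>m (z + 1 - \<omega>) = \<Phi>m (z - \<omega>) + 1"
      using m1[of "z - \<omega>"] z by (simp add: algebra_simps)
    moreover have "P (z + 1) = P z + (Q (z + 1 - \<omega>) - Q (z - \<omega>))"
      using PQ[OF zU zV] by (simp add: algebra_simps)
    moreover have "\<Phi>p (z + 1) = \<Phi>p z + 1" using p1 z e by simp
    ultimately show "R (z + 1) - R z = \<Phi>p z - \<Phi>m (z - \<omega>) - g"
      unfolding R_def by (simp only:) (simp add: power2_eq_square field_simps)
  qed
qed

text \<open>The bound of Schottky's theorem for a function with value \<open>1/2\<close> at the centre of the unit disc, on
  the disc of radius \<open>3/4\<close>, transported to the normalization in the next lemma.\<close>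

definition coordinate_oscillation_bound :: real where
  "coordinate_oscillation_bound = 2 * exp (pi * exp (pi * (3 + 12 * (3/4) / (1 - 3/4)))) + 1"

text \<open>The function \<open>(f - f z0 + 1) / 2\<close> omits \<open>0\<close> and \<open>1\<close>, so Schottky's theorem bounds it by an absolute
  constant on smaller discs. A coordinate that is injective modulo \<open>\<int>\<close> omits \<open>f z0 \<plusminus> 1\<close>
  in the disc: values with an integer difference are taken at points with an integer difference, and
  two different points at distance less than \<open>1\<close> are not of this kind.\<close>

lemma oscillation_bound:
  assumes hol: "f holomorphic_on ball z0 1"
    and omit: "\<And>z. z \<in> ball z0 1 \<Longrightarrow> f z - f z0 \<noteq> 1 \<and> f z - f z0 \<noteq> -1"
    and "norm (z - z0) \<le> 1 / 2"
  shows "norm (f z - f z0) \<le> coordinate_oscillation_bound"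
proof -
  \<comment> \<open>The radius \<open>4/5\<close> keeps the closed disc inside the unit disc, and \<open>1/2 < 3/4 * 4/5\<close>.\<close>
  define k where "k u = (f (z0 + of_real (4/5) * u) - f z0 + 1) / 2" for u
  define u where "u = (z - z0) * of_real (5/4)"
  have inb: "z0 + of_real (4/5) * u \<in> ball z0 1" if "u \<in> cball 0 1" for u
    using that by (simp add: dist_norm norm_mult)
  have "(f \<circ> (\<lambda>u. z0 + of_real (4/5) * u)) holomorphic_on cball 0 1"
    by (intro holomorphic_on_compose_gen[OF _ hol] holomorphic_intros) (use inb in blast)
  then have "k holomorphic_on cball 0 1"
    unfolding k_def o_def by (intro holomorphic_intros) auto
  then have "norm (k u) \<le> exp (pi * exp (pi * (2 + 2 * (1/2) + 12 * (3/4) / (1 - 3/4))))"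
  proof (rule Schottky)
    show "norm (k 0) \<le> 1 / 2" by (simp add: k_def)
    show "norm u \<le> 3 / 4" using assms(3) unfolding u_def norm_mult norm_of_real by simp
    fix u :: complex assume "u \<in> cball 0 1"
    then show "\<not> (k u = 0 \<or> k u = 1)"
      using omit[OF inb[of u]] by (auto simp: k_def algebra_simps eq_neg_iff_add_eq_0)
  qed auto
  moreover have "z0 + of_real (4/5) * u = z" by (simp add: u_def field_simps)
  then have "f z - f z0 = 2 * k u - 1" by (simp add: k_def field_simps)
  then have "norm (f z - f z0) \<le> 2 * norm (k u) + 1"
    using norm_triangle_ineq4[of "2 * k u" 1] by (simp add: norm_mult)
  ultimately show ?thesis by (simp add: coordinate_oscillation_bound_def)
qed

text \<open>On the line \<open>Im z = Im \<omega> / 2\<close> both coordinates of the sides are close to translations, so the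
  factor \<open>d(\<Phi>p - \<Phi>m(\<cdot> - \<omega>))\<close> of the integrand is small, while \<open>H - c\<close> is bounded independently of
  \<open>\<omega>\<close> by \<open>oscillation_bound\<close>. With base point \<open>z + 1/2\<close> the whole interval from \<open>z\<close> to
  \<open>z + 1\<close> lies in the disc of radius \<open>1/2\<close> considered there.\<close>

lemma gluing_period_estimate:
  fixes H \<Phi>p \<Phi>m G :: "complex \<Rightarrow> complex"
  assumes e: "0 < e"
    and om: "2 < Im \<omega>"
    and H: "H holomorphic_on strip (-e) (Im \<omega>)"
    and p: "\<Phi>p holomorphic_on {z. -e < Im z}"
    and m: "\<Phi>m holomorphic_on {z. Im z < 0}"
    and G: "G holomorphic_on strip (-e) e"
    and G_lower: "\<And>z. z \<in> strip (-e) 0 \<Longrightarrow> G z \<in> strip (-1) 0"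
    and H1: "\<And>z. z \<in> strip (-e) (Im \<omega>) \<Longrightarrow> H (z + 1) = H z + 1"
    and p1: "\<And>z. -e < Im z \<Longrightarrow> \<Phi>p (z + 1) = \<Phi>p z + 1"
    and m1: "\<And>z. Im z < 0 \<Longrightarrow> \<Phi>m (z + 1) = \<Phi>m z + 1"
    and G1: "\<And>z. z \<in> strip (-e) e \<Longrightarrow> G (z + 1) = G z + 1"
    and pm: "\<And>z. z \<in> strip (-e) 0 \<Longrightarrow> \<Phi>m (G z) = \<Phi>p z"
    and Hg: "\<And>z. z \<in> strip (-e) 0 \<Longrightarrow> H (G z + \<omega>) = H z + g"
    and inj: "\<And>z w. z \<in> strip 0 (Im \<omega>) \<Longrightarrow> w \<in> strip 0 (Im \<omega>) \<Longrightarrow> H z - H w \<in> \<int> \<Longrightarrow> z - w \<in> \<int>"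
    and small_p: "\<And>z. Im z = Im \<omega> / 2 \<Longrightarrow> norm (deriv \<Phi>p z - 1) \<le> \<delta>"
    and small_m: "\<And>z. Im z = - Im \<omega> / 2 \<Longrightarrow> norm (deriv \<Phi>m z - 1) \<le> \<delta>"
    and z: "Im z = Im \<omega> / 2"
  shows "norm (\<Phi>p z - \<Phi>m (z - \<omega>) - g) \<le> 2 * coordinate_oscillation_bound * \<delta>"
proof -
  define c where "c = z + 1/2"
  have imc: "Im c = Im \<omega> / 2" using z by (simp add: c_def)
  have ballU: "w \<in> strip 0 (Im \<omega>)" if "w \<in> ball c 1" for w
    using that abs_Im_le_cmod[of "c - w"] imc om by (auto simp: dist_norm)
  have osc: "norm (H w - H c) \<le> coordinate_oscillation_bound" if w: "norm (w - c) \<le> 1/2" for w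
  proof (rule oscillation_bound[OF holomorphic_on_subset[OF H] _ w])
    show "ball c 1 \<subseteq> strip (- e) (Im \<omega>)" using ballU e by force
    fix w assume w: "w \<in> ball c 1"
    show "H w - H c \<noteq> 1 \<and> H w - H c \<noteq> - 1"
    proof (rule ccontr)
      assume "\<not> ?thesis"
      then have I: "H w - H c \<in> \<int>" "H w \<noteq> H c" by auto
      then have "w - c \<in> \<int>" using inj ballU w by (metis centre_in_ball zero_less_one)
      then have "w = c" using dist_Ints_ge_1[of "w - c" 0] w by (force simp: dist_norm norm_minus_commute)
      then show False using I by simp
    qed
  qed
  obtain R where
    R': "\<And>z. z \<in> strip 0 (Im \<omega>) \<Longrightarrow>
       (R has_field_derivative (H z - H c) * (deriv \<Phi>p z - deriv \<Phi>m (z - \<omega>))) (at z)" and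
    R1: "\<And>z. z \<in> strip 0 (Im \<omega>) \<Longrightarrow> R (z + 1) - R z = \<Phi>p z - \<Phi>m (z - \<omega>) - g"
    using gluing_period_defect[of e \<omega> H \<Phi>p \<Phi>m G g "H c",
        OF e _ H p m G G_lower H1 p1 m1 G1 pm Hg] om
    by (smt (verit, best))
  have seg: "Im w = Im \<omega> / 2 \<and> norm (w - c) \<le> 1/2" if "w \<in> closed_segment z (z + 1)" for w
  proof -
    obtain t where t: "w = (1 - t) *\<^sub>R z + t *\<^sub>R (z + 1)" "0 \<le> t" "t \<le> 1"
      using \<open>w \<in> closed_segment z (z + 1)\<close> by (auto simp: in_segment)
    have "w = z + of_real t" by (simp add: t(1) scaleR_conv_of_real algebra_simps)
    then have "Im w = Im \<omega> / 2" "w - c = of_real (t - 1/2)" using z by (simp_all add: c_def)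
    moreover have "\<bar>t - 1/2\<bar> \<le> 1/2" using t(2,3) unfolding abs_le_iff by auto
    ultimately show ?thesis by (simp only: norm_of_real)
  qed
  have "norm (R (z + 1) - R z) \<le> (coordinate_oscillation_bound * (2 * \<delta>)) * norm (z + 1 - z)"
  proof (rule field_differentiable_bound[where S = "closed_segment z (z + 1)"])
    fix w assume "w \<in> closed_segment z (z + 1)"
    then have w: "Im w = Im \<omega> / 2" "norm (w - c) \<le> 1/2" using seg by auto
    then show "(R has_field_derivative (H w - H c) * (deriv \<Phi>p w - deriv \<Phi>m (w - \<omega>)))
       (at w within closed_segment z (z + 1))"
      using R'[of w] om by (auto intro: has_field_derivative_at_within)
    have "norm (deriv \<Phi>p w - deriv \<Phi>m (w - \<omega>))
       \<le> norm (deriv \<Phi>p w - 1) + norm (deriv \<Phi>m (w - \<omega>) - 1)"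
      using norm_triangle_ineq4[of "deriv \<Phi>p w - 1" "deriv \<Phi>m (w - \<omega>) - 1"] by simp
    also have "\<dots> \<le> 2 * \<delta>" using small_p[of w] small_m[of "w - \<omega>"] w by simp
    finally show "norm ((H w - H c) * (deriv \<Phi>p w - deriv \<Phi>m (w - \<omega>)))
       \<le> coordinate_oscillation_bound * (2 * \<delta>)"
      unfolding norm_mult using osc[OF w(2)] by (intro mult_mono) (auto intro: order_trans[OF norm_ge_zero])
  qed auto
  then show ?thesis using R1[of z] z om by simp
qed
section \<open>Holomorphic extension of a circle diffeomorphism\<close>

lemma circle_lift_add_int:
  assumes "analytic_circle_diffeo F"
  shows "F (x + of_int k) = F x + of_int k"
proof -
  have per: "F (x + 1) = F x + 1" for x
    using assms by (simp add: analytic_circle_diffeo_def)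
  have pern: "F (x + real n) = F x + real n" for x n
    by (induction n) (auto simp: per add.assoc[symmetric] add.commute[of 1])
  show ?thesis
  proof (cases "k \<ge> 0")
    case True
    then show ?thesis using pern[of x "nat k"] by simp
  next
    case False
    then show ?thesis using pern[of "x + of_int k" "nat (- k)"] by simp
  qed
qed

lemma periodic_on_strip_add_int:
  assumes "\<And>z. z \<in> strip a b \<Longrightarrow> f (z + 1) = f z" "z \<in> strip a b"
  shows "f (z + of_int k) = f z"
proof -
  have n: "f (z + of_nat n) = f z" if "z \<in> strip a b" for z n
  proof (induction n)
    case (Suc n)
    have "f (z + of_nat n + 1) = f (z + of_nat n)" using that by (intro assms(1)) auto
    then show ?case using Suc by (simp add: add_ac)
  qed simp
  show ?thesis
  proof (cases "k \<ge> 0")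
    case True
    then show ?thesis using n[OF assms(2), of "nat k"] by simp
  next
    case False
    then show ?thesis using n[of "z + of_int k" "nat (- k)"] assms(2) by simp
  qed
qed

lemma holomorphic_eq_if_eq_on_reals:
  assumes "f holomorphic_on W" "g holomorphic_on W" "open W" "connected W" "of_real t0 \<in> W" "w \<in> W"
    and eq: "\<And>t. of_real t \<in> W \<Longrightarrow> f (of_real t) = g (of_real t)"
  shows "f w = g w"
proof -
  have "f w - g w = 0"
  proof (rule analytic_continuation[where f = "\<lambda>w. f w - g w" and S = W and U = "W \<inter> \<real>" and \<xi> = "of_real t0"])
    show "(\<lambda>w. f w - g w) holomorphic_on W" by (intro holomorphic_intros assms)
    obtain d where d: "0 < d" "ball (of_real t0) d \<subseteq> W" using assms openE by blast
    show "complex_of_real t0 islimpt W \<inter> \<real>"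
      unfolding islimpt_approachable
    proof (intro allI impI)
      fix e :: real assume "0 < e"
      define s where "s = t0 + min e d / 2"
      have "complex_of_real s \<in> ball (of_real t0) d" "complex_of_real s \<noteq> of_real t0"
        "dist (complex_of_real s) (of_real t0) < e"
        using d(1) \<open>0 < e\<close> by (auto simp: s_def dist_norm min_def simp flip: of_real_diff of_real_add)
      then show "\<exists>x'\<in>W \<inter> \<real>. x' \<noteq> of_real t0 \<and> dist x' (of_real t0) < e"
        using d(2) by (intro bexI[of _ "of_real s"]) auto
    qed
  qed (use assms in \<open>auto elim!: Reals_cases\<close>)
  then show ?thesis by simp
qed

lemma real_analytic_local_extension:
  assumes "real_analytic F"
  obtains r S where "0 < r" "S holomorphic_on ball (of_real x) r"
    "\<And>t. \<bar>t - x\<bar> < r \<Longrightarrow> S (of_real t) = of_real (F t)"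
proof -
  obtain r a where r: "0 < r" and a: "\<And>y. \<bar>y - x\<bar> < r \<Longrightarrow> (\<lambda>n. a n * (y - x) ^ n) sums F y"
    using assms unfolding real_analytic_def by metis
  define S where "S z = (\<Sum>n. of_real (a n) * (z - of_real x) ^ n)" for z :: complex
  have "(\<lambda>n. of_real (a n) * (z - of_real x) ^ n) sums S z" if "z \<in> ball (of_real x) r" for z
  proof -
    have "norm (z - of_real x) < r" using that by (simp add: dist_norm norm_minus_commute)
    then obtain s where s: "norm (z - of_real x) < s" "s < r" using dense by blast
    then have s0: "0 < s" using norm_ge_zero le_less_trans by blast
    have "summable (\<lambda>n. complex_of_real (a n) * of_real s ^ n)"
      using sums_summable[OF a[of "x + s"]] s s0
      by (simp flip: of_real_power of_real_mult add: summable_of_real)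
    then have "summable (\<lambda>n. complex_of_real (a n) * (z - of_real x) ^ n)"
      by (rule powser_inside) (use s s0 in auto)
    then show ?thesis unfolding S_def by (rule summable_sums)
  qed
  then have "S holomorphic_on ball (of_real x) r" by (rule power_series_holomorphic)
  moreover have "S (of_real t) = of_real (F t)" if "\<bar>t - x\<bar> < r" for t
  proof -
    have "(\<lambda>n. complex_of_real (a n * (t - x) ^ n)) sums of_real (F t)"
      using a[OF that] by (simp only: sums_of_real_iff)
    then show ?thesis unfolding S_def by (simp add: sums_iff)
  qed
  ultimately show ?thesis using r that by blast
qed

text \<open>Periodicity reduces the choice of radii to the compact interval \<open>[0, 1]\<close>, where a Lebesgue number
  of the cover by discs of convergence serves for all points.\<close>

lemma circle_diffeo_uniform_local_extension:
  assumes F: "analytic_circle_diffeo F"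
  obtains e where "0 < e" "\<And>x. \<exists>S. S holomorphic_on ball (of_real x) e \<and>
      (\<forall>t. \<bar>t - x\<bar> < e \<longrightarrow> S (of_real t) = of_real (F t))"
proof -
  have "real_analytic F" using F by (simp add: analytic_circle_diffeo_def)
  then have "\<exists>r S. 0 < r \<and> S holomorphic_on ball (of_real x) r \<and>
      (\<forall>t. \<bar>t - x\<bar> < r \<longrightarrow> S (of_real t) = of_real (F t))" for x
    using real_analytic_local_extension by metis
  then obtain r S where r: "\<And>x. 0 < r x" and S: "\<And>x. S x holomorphic_on ball (of_real x) (r x)"
    and SF: "\<And>x t. \<bar>t - x\<bar> < r x \<Longrightarrow> S x (of_real t) = of_real (F t)" by metis
  have "compact (complex_of_real ` {0..1})"
    by (intro compact_continuous_image continuous_intros) auto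
  then obtain e where e: "0 < e"
    and cover: "\<forall>z\<in>complex_of_real ` {0..1}. \<exists>B\<in>range (\<lambda>x. ball (of_real x) (r x)). ball z e \<subseteq> B"
  proof (rule Heine_Borel_lemma[where \<G> = "range (\<lambda>x. ball (of_real x) (r x))"])
    show "complex_of_real ` {0..1} \<subseteq> \<Union> (range (\<lambda>x. ball (of_real x) (r x)))"
      using r by (auto, metis dist_self)
  qed auto
  have "\<exists>T. T holomorphic_on ball (of_real x) e \<and>
      (\<forall>t. \<bar>t - x\<bar> < e \<longrightarrow> T (of_real t) = of_real (F t))" for x
  proof -
    have "complex_of_real (frac x) \<in> of_real ` {0..1}"
      using frac_ge_0[of x] frac_lt_1[of x] by (intro imageI) auto
    then obtain y where y: "ball (complex_of_real (frac x)) e \<subseteq> ball (of_real y) (r y)"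
      using cover by blast
    define k where "k = \<lfloor>x\<rfloor>"
    have xk: "x = frac x + of_int k" by (simp add: frac_def k_def)
    have sh: "z - of_int k \<in> ball (of_real (frac x)) e" if "z \<in> ball (of_real x) e" for z :: complex
    proof -
      have "complex_of_real x = of_real (frac x) + of_int k" using xk by (metis of_real_add of_real_of_int_eq)
      then show ?thesis using that by (simp add: dist_norm algebra_simps)
    qed
    define T where "T z = S y (z - of_int k) + of_int k" for z
    have "(S y \<circ> (\<lambda>z. z - of_int k)) holomorphic_on ball (of_real x) e"
      by (intro holomorphic_on_compose_gen[OF _ S[of y]] holomorphic_intros) (use sh y in blast)
    then have "T holomorphic_on ball (of_real x) e"
      unfolding T_def o_def by (intro holomorphic_intros)
    moreover have "T (of_real t) = of_real (F t)" if "\<bar>t - x\<bar> < e" for t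
    proof -
      have "complex_of_real t \<in> ball (of_real x) e"
        using that by (simp add: dist_real_def abs_minus_commute)
      from sh[OF this] have "complex_of_real (t - of_int k) \<in> ball (of_real y) (r y)"
        using y by auto
      then have "\<bar>(t - of_int k) - y\<bar> < r y"
        by (simp only: mem_ball dist_of_real dist_real_def abs_minus_commute)
      from SF[OF this] show ?thesis
        using circle_lift_add_int[OF F, of "t - of_int k" k] by (simp add: T_def)
    qed
    ultimately show ?thesis by blast
  qed
  with e show ?thesis using that by blast
qed

text \<open>The local extensions on discs centred on the real axis agree on overlaps, since the intersection
  of two such discs is convex and contains with every point its real part.\<close>

lemma circle_diffeo_extension_to_strip:
  assumes F: "analytic_circle_diffeo F"
  obtains e G where "0 < e" "G holomorphic_on strip (-e) e"
    "\<And>x. G (of_real x) = of_real (F x)"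
    "\<And>z. z \<in> strip (-e) e \<Longrightarrow> G (z + 1) = G z + 1"
proof -
  obtain e where e: "0 < e" and "\<And>x. \<exists>S. S holomorphic_on ball (of_real x) e \<and>
      (\<forall>t. \<bar>t - x\<bar> < e \<longrightarrow> S (of_real t) = of_real (F t))"
    using circle_diffeo_uniform_local_extension[OF F] by blast
  then obtain S where S: "\<And>x. S x holomorphic_on ball (of_real x) e"
    and SF: "\<And>x t. \<bar>t - x\<bar> < e \<Longrightarrow> S x (of_real t) = of_real (F t)" by metis
  have agree: "S x z = S y z" if z: "z \<in> ball (of_real x) e" "z \<in> ball (of_real y) e" for x y z
  proof (rule holomorphic_eq_if_eq_on_reals[of "S x" "ball (of_real x) e \<inter> ball (of_real y) e" "S y" "Re z"])
    show "S x holomorphic_on ball (of_real x) e \<inter> ball (of_real y) e"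
      "S y holomorphic_on ball (of_real x) e \<inter> ball (of_real y) e"
      using S holomorphic_on_subset by blast+
    show "connected (ball (complex_of_real x) e \<inter> ball (of_real y) e)"
      by (intro convex_connected convex_Int) auto
    have "\<bar>x - Re z\<bar> \<le> norm (of_real x - z)" "\<bar>y - Re z\<bar> \<le> norm (of_real y - z)"
      using abs_Re_le_cmod[of "of_real x - z"] abs_Re_le_cmod[of "of_real y - z"] by auto
    then show "complex_of_real (Re z) \<in> ball (of_real x) e \<inter> ball (of_real y) e"
      using z by (auto simp: dist_norm simp flip: of_real_diff)
    show "S x (of_real t) = S y (of_real t)"
      if "complex_of_real t \<in> ball (of_real x) e \<inter> ball (of_real y) e" for t
      using that SF[of t x] SF[of t y] by (auto simp: dist_real_def abs_minus_commute)
  qed (use z in auto)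
  define G where "G z = S (Re z) z" for z
  have near: "z \<in> ball (of_real (Re z)) e" if "z \<in> strip (-e) e" for z
  proof -
    have "of_real (Re z) - z = - (\<i> * of_real (Im z))" by (simp add: complex_eq_iff)
    then have "norm (of_real (Re z) - z) = \<bar>Im z\<bar>" by (simp add: norm_mult)
    then show ?thesis using that by (auto simp: dist_norm)
  qed
  have hol: "G holomorphic_on strip (-e) e"
  proof (rule holomorphic_onI)
    fix z assume z: "z \<in> strip (-e) e"
    let ?W = "ball (of_real (Re z)) e \<inter> strip (-e) e"
    have "G holomorphic_on ?W"
    proof (rule holomorphic_transform)
      show "S (Re z) holomorphic_on ?W" using S holomorphic_on_subset by blast
      show "S (Re z) w = G w" if "w \<in> ?W" for w
        using agree[of w "Re z" "Re w"] near[of w] that by (auto simp: G_def)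
    qed
    then show "G field_differentiable at z within strip (-e) e"
      using holomorphic_on_imp_differentiable_at[of G ?W z] near[OF z] z open_strip
      by (auto intro: field_differentiable_at_within)
  qed
  have real: "G (of_real x) = of_real (F x)" for x using SF[of x x] e by (simp add: G_def)
  have "G (z + 1) = G z + 1" if z: "z \<in> strip (-e) e" for z
  proof (rule holomorphic_eq_if_eq_on_reals[where f = "\<lambda>z. G (z + 1)" and g = "\<lambda>z. G z + 1" and ?t0.0 = 0,
        OF _ _ open_strip convex_connected[OF convex_strip]])
    have "(G \<circ> (\<lambda>z. z + 1)) holomorphic_on strip (-e) e"
      by (intro holomorphic_on_compose_gen[OF _ hol] holomorphic_intros) auto
    then show "(\<lambda>z. G (z + 1)) holomorphic_on strip (-e) e" by (simp add: o_def)
    show "(\<lambda>z. G z + 1) holomorphic_on strip (-e) e" by (intro holomorphic_intros hol)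
    show "of_real 0 \<in> strip (-e) e" using e by simp
    show "G (of_real t + 1) = G (of_real t) + 1" for t
      using circle_lift_add_int[OF F, of t 1] real[of t] real[of "t + 1"] by simp
  qed (use z in auto)
  with e hol real show ?thesis using that by blast
qed

lemma mono_holomorphic_deriv_nonneg:
  assumes "mono F" and G: "(G has_field_derivative D) (at (of_real t))"
    and real: "\<And>x. G (of_real x) = of_real (F x)"
  shows "0 \<le> Re D" "Im D = 0"
proof -
  have "((\<lambda>h. (G (of_real t + h) - G (of_real t)) / h) \<longlongrightarrow> D) (at 0)"
    using G by (simp add: DERIV_def)
  moreover have "filterlim complex_of_real (at 0) (at 0)"
    by (rule filterlim_atI) (auto intro!: tendsto_eq_intros simp: eventually_at_filter)
  ultimately have "((\<lambda>h. (G (of_real t + of_real h) - G (of_real t)) / of_real h) \<longlongrightarrow> D) (at 0)"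
    by (rule filterlim_compose)
  then have lim: "((\<lambda>h. complex_of_real ((F (t + h) - F t) / h)) \<longlongrightarrow> D) (at 0)"
    by (simp add: real flip: of_real_add)
  have nn: "0 \<le> (F (t + h) - F t) / h" for h
    using monoD[OF assms(1), of t "t + h"] monoD[OF assms(1), of "t + h" t]
    by (cases "h \<ge> 0") (auto simp: zero_le_divide_iff)
  show "0 \<le> Re D"
    using tendsto_lowerbound[OF tendsto_Re[OF lim]] nn by (simp add: eventually_at_filter)
  show "Im D = 0"
    using tendsto_unique[OF _ tendsto_Im[OF lim], of 0] by simp
qed

text \<open>The derivative is a limit of nonnegative real difference quotients. It does not vanish, because
  the inverse of \<open>F\<close> extends holomorphically too and inverts the extension of \<open>F\<close> near \<open>t\<close>.\<close>

lemma circle_diffeo_extension_deriv_pos: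
  assumes F: "analytic_circle_diffeo F" and e: "0 < e" and G: "G holomorphic_on strip (-e) e"
    and real: "\<And>x. G (of_real x) = of_real (F x)"
  shows "0 < Re (deriv G (of_real t))"
proof -
  have dG: "(G has_field_derivative deriv G (of_real t)) (at (of_real t))"
    using holomorphic_derivI[OF G open_strip] e by simp
  have "mono F" using F by (simp add: analytic_circle_diffeo_def strict_mono_mono)
  note nonneg = mono_holomorphic_deriv_nonneg[OF this dG real]
  have "real_analytic (inv F)" using F by (simp add: analytic_circle_diffeo_def)
  then obtain r S where r: "0 < r" and S: "S holomorphic_on ball (of_real (F t)) r"
    and SF: "\<And>s. \<bar>s - F t\<bar> < r \<Longrightarrow> S (of_real s) = of_real (inv F s)"
    using real_analytic_local_extension[of "inv F" "F t"] by metis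
  have "isCont G (of_real t)" using dG DERIV_isCont by blast
  then have "\<exists>d>0. \<forall>z. dist z (of_real t) < d \<longrightarrow> dist (G z) (G (of_real t)) < r"
    using r unfolding continuous_at_eps_delta by blast
  then obtain d where d: "0 < d" and dr: "\<And>z. dist z (of_real t) < d \<Longrightarrow> dist (G z) (of_real (F t)) < r"
    using real by auto
  define W where "W = ball (complex_of_real t) d \<inter> strip (-e) e"
  have W: "open W" "connected W" "of_real t \<in> W"
    using d e open_strip convex_strip unfolding W_def by (auto intro!: convex_connected convex_Int)
  have SG: "S (G z) = z" if "z \<in> W" for z
  proof (rule holomorphic_eq_if_eq_on_reals[where f = "\<lambda>z. S (G z)" and g = "\<lambda>z. z", OF _ _ W that])
    have "(S \<circ> G) holomorphic_on W"
      by (intro holomorphic_on_compose_gen[OF _ S] holomorphic_on_subset[OF G])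
        (use dr in \<open>auto simp: W_def dist_commute\<close>)
    then show "(\<lambda>z. S (G z)) holomorphic_on W" by (simp add: o_def)
    show "S (G (of_real s)) = of_real s" if "of_real s \<in> W" for s
    proof -
      have "dist (G (of_real s)) (of_real (F t)) < r" using dr that by (auto simp: W_def dist_commute)
      then have "\<bar>F s - F t\<bar> < r" by (simp add: real dist_real_def)
      then show ?thesis using SF F by (simp add: real analytic_circle_diffeo_def bij_is_inj)
    qed
  qed (intro holomorphic_intros)
  have "(S has_field_derivative deriv S (G (of_real t))) (at (G (of_real t)))"
    using holomorphic_derivI[OF S] r by (simp add: real)
  then have "((\<lambda>z. S (G z)) has_field_derivative deriv S (G (of_real t)) * deriv G (of_real t)) (at (of_real t))"
    using DERIV_chain2 dG by blast
  then have "((\<lambda>z. z) has_field_derivative deriv S (G (of_real t)) * deriv G (of_real t)) (at (of_real t))"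
    by (rule has_field_derivative_transform_within_open[OF _ W(1,3)]) (rule SG)
  then have "deriv S (G (of_real t)) * deriv G (of_real t) = 1"
    using DERIV_ident DERIV_unique by blast
  then have "deriv G (of_real t) \<noteq> 0" by auto
  then show ?thesis using nonneg by (auto simp: complex_eq_iff less_le)
qed

text \<open>The criterion of Noshiro and Warschawski: a holomorphic function whose derivative has positive
  real part on a convex set is injective. With \<open>w = Re z\<close>, it also shows that the extension of a circle diffeomorphism preserves the lower half-plane near the real axis.\<close>

lemma Re_difference_quotient_pos:
  assumes "convex U" "\<And>u. u \<in> U \<Longrightarrow> (f has_field_derivative f' u) (at u)"
    and "\<And>u. u \<in> U \<Longrightarrow> 0 < Re (f' u)" "z \<in> U" "w \<in> U" "z \<noteq> w"
  shows "0 < Re ((f z - f w) / (z - w))"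
proof -
  have sub: "closed_segment w z \<subseteq> U" using assms by (simp add: closed_segment_subset)
  have "((\<lambda>u. f u / (z - w)) has_field_derivative f' u / (z - w)) (at u)" if "u \<in> closed_segment w z" for u
    using assms(2)[of u] that sub by (intro DERIV_cdivide) auto
  from complex_mvt_line[of w z "\<lambda>u. f u / (z - w)", OF this]
  obtain u where "u \<in> closed_segment w z" "Re (f z / (z - w)) - Re (f w / (z - w)) = Re (f' u)"
    using assms(6) by auto
  then show ?thesis using assms(3)[of u] sub unfolding diff_divide_distrib minus_complex.sel by auto
qed

lemma circle_diffeo_univalent_extension:
  assumes F: "analytic_circle_diffeo F"
  obtains e G where "0 < e" "e \<le> 1" "G holomorphic_on strip (-e) e" "inj_on G (strip (-e) e)"
    "\<And>x. G (of_real x) = of_real (F x)"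
    "\<And>z k. z \<in> strip (-e) e \<Longrightarrow> G (z + of_int k) = G z + of_int k"
    "\<And>z. z \<in> strip (-e) 0 \<Longrightarrow> G z \<in> strip (-1) 0"
proof -
  obtain d G where d: "0 < d" and G: "G holomorphic_on strip (-d) d"
    and real: "\<And>x. G (of_real x) = of_real (F x)"
    and G1: "\<And>z. z \<in> strip (-d) d \<Longrightarrow> G (z + 1) = G z + 1"
    using circle_diffeo_extension_to_strip[OF F] by blast
  have G'1: "deriv G (z + 1) = deriv G z" if "z \<in> strip (-d) d" for z
    using deriv_periodic[OF open_strip G that] G1 that by simp
  \<comment> \<open>A neighbourhood of the compact set \<open>[0, 1]\<close>, and by periodicity one of a whole strip.\<close>
  define W where "W = {z \<in> strip (-d) d. 0 < Re (deriv G z) \<and> \<bar>Im (G z)\<bar> < 1}"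
  have "open (strip (-d) d \<inter> (\<lambda>z. (Re (deriv G z), \<bar>Im (G z)\<bar>)) -` ({0<..} \<times> {..<1}))"
    by (intro continuous_open_preimage[OF _ open_strip] continuous_intros open_Times
      holomorphic_on_imp_continuous_on[OF G] holomorphic_on_imp_continuous_on[OF holomorphic_deriv[OF G open_strip]])
  moreover have "W = strip (-d) d \<inter> (\<lambda>z. (Re (deriv G z), \<bar>Im (G z)\<bar>)) -` ({0<..} \<times> {..<1})"
    by (auto simp: W_def)
  ultimately have "open W" by simp
  moreover have "compact (complex_of_real ` {0..1})"
    by (intro compact_continuous_image continuous_intros) auto
  moreover have "complex_of_real ` {0..1} \<subseteq> W"
    using circle_diffeo_extension_deriv_pos[OF F d G real] d by (auto simp: W_def real)
  ultimately obtain e0 where e0: "0 < e0" "(\<Union>x\<in>complex_of_real ` {0..1}. ball x e0) \<subseteq> W"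
    using compact_subset_open_imp_ball_epsilon_subset by metis
  define e where "e = min 1 (min e0 d)"
  have e: "0 < e" "e \<le> 1" "e \<le> e0" "e \<le> d" using e0 d by (auto simp: e_def)
  have W: "z \<in> W" if "z \<in> strip (-e) e" for z
  proof -
    define k where "k = \<lfloor>Re z\<rfloor>"
    define w where "w = z - of_int k"
    have "of_real (frac (Re z)) - w = - (\<i> * of_real (Im z))"
      by (simp add: complex_eq_iff w_def k_def frac_def)
    then have "norm (of_real (frac (Re z)) - w) = \<bar>Im z\<bar>" by (simp add: norm_mult)
    then have "w \<in> ball (of_real (frac (Re z))) e0" using that e by (auto simp: dist_norm)
    moreover have "complex_of_real (frac (Re z)) \<in> of_real ` {0..1}"
      using frac_ge_0[of "Re z"] frac_lt_1[of "Re z"] by (intro imageI) auto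
    ultimately have w: "w \<in> W" using e0 by blast
    then have ws: "w \<in> strip (-d) d" by (auto simp: W_def)
    have "deriv G z = deriv G w" 
      using periodic_on_strip_add_int[of "-d" d "deriv G" w k] G'1 ws by (simp add: w_def)
    moreover have "Im (G z) = Im (G w)"
      using periodic_on_strip_add_int[of "-d" d "\<lambda>z. Im (G z)" w k] G1 ws by (simp add: w_def)
    ultimately show ?thesis using w ws by (auto simp: W_def w_def)
  qed
  have q: "0 < Re ((G z - G w) / (z - w))" if "z \<in> strip (-e) e" "w \<in> strip (-e) e" "z \<noteq> w" for z w
  proof (rule Re_difference_quotient_pos[OF convex_strip _ _ that])
    fix u assume "u \<in> strip (-e) e"
    with W show "0 < Re (deriv G u)" "(G has_field_derivative deriv G u) (at u)"
      using holomorphic_derivI[OF G open_strip] by (auto simp: W_def)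
  qed
  show ?thesis
  proof (rule that[OF e(1,2) holomorphic_on_subset[OF G] _ real])
    show "strip (-e) e \<subseteq> strip (-d) d" using e by auto
    show "inj_on G (strip (-e) e)"
      using q by (intro inj_onI) (metis cancel_comm_monoid_add_class.diff_cancel div_0 less_irrefl zero_complex.sel(1))
    show "G (z + of_int k) = G z + of_int k" if "z \<in> strip (-e) e" for z k
      using periodic_on_strip_add_int[of "-d" d "\<lambda>z. G z - z" z k] G1 that e
      by (simp add: algebra_simps)
    show "G z \<in> strip (-1) 0" if z: "z \<in> strip (-e) 0" for z
    proof -
      have zs: "z \<in> strip (-e) e" using z e by auto
      have eq: "z - of_real (Re z) = \<i> * of_real (Im z)" by (simp add: complex_eq_iff)
      have "0 < Re ((G z - G (of_real (Re z))) / (z - of_real (Re z)))"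
        using z e by (intro q) (auto simp: complex_eq_iff)
      also have "\<dots> = Im (G z) / Im z"
        using z by (simp add: eq real Re_divide power2_eq_square)
      finally have "Im (G z) < 0" using z by (simp add: zero_less_divide_iff)
      then show ?thesis using W[OF zs] by (auto simp: W_def)
    qed
  qed
qed
section \<open>Lifting maps from the compactified cylinder to the plane\<close>

lemma coset_eq_iff:
  assumes "0 \<in> \<Gamma>" "\<And>x y. x \<in> \<Gamma> \<Longrightarrow> y \<in> \<Gamma> \<Longrightarrow> x - y \<in> \<Gamma>"
  shows "coset \<Gamma> z = coset \<Gamma> w \<longleftrightarrow> z - w \<in> \<Gamma>"
proof
  assume "coset \<Gamma> z = coset \<Gamma> w"
  moreover have "z \<in> coset \<Gamma> z" using assms(1) by (auto simp: coset_def intro!: exI[of _ 0])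
  ultimately show "z - w \<in> \<Gamma>" by (auto simp: coset_def)
next
  have neg: "- x \<in> \<Gamma>" if "x \<in> \<Gamma>" for x using assms(2)[OF assms(1) that] by simp
  have add: "x + y \<in> \<Gamma>" if "x \<in> \<Gamma>" "y \<in> \<Gamma>" for x y using assms(2)[OF that(1) neg[OF that(2)]] by simp
  assume zw: "z - w \<in> \<Gamma>"
  have "z + g = w + (z - w + g)" "w + g = z + (g - (z - w))" for g by simp_all
  then show "coset \<Gamma> z = coset \<Gamma> w"
    unfolding coset_def using add[OF zw] assms(2)[OF _ zw] by blast
qed

lemma coset_Ints_eq_iff: "coset \<int> z = coset \<int> w \<longleftrightarrow> z - w \<in> \<int>"
  by (rule coset_eq_iff) auto

text \<open>The parametrization of the compactified cylinder around \<open>PlusInf\<close>, which misses only \<open>MinusInf\<close>.\<close>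

definition cylinder_chart :: "complex \<Rightarrow> complex set with_ends" where
  "cylinder_chart q = (if q = 0 then PlusInf else Fin (coset \<int> (upper_log q)))"

lemma upper_log_exp: "upper_log (exp (2 * of_real pi * \<i> * w)) - w \<in> \<int>"
proof -
  have "exp (Ln (exp (2 * of_real pi * \<i> * w))) = exp (2 * of_real pi * \<i> * w)" by simp
  then obtain n :: int where "Ln (exp (2 * of_real pi * \<i> * w)) =
      2 * of_real pi * \<i> * w + of_real (of_int (2 * n) * pi) * \<i>"
    unfolding exp_eq by blast
  then have "upper_log (exp (2 * of_real pi * \<i> * w)) - w = of_int n"
    by (simp add: upper_log_def field_simps)
  then show ?thesis by simp
qed

lemma inj_cylinder_chart: "inj cylinder_chart"
proof (rule injI)
  fix p q assume eq: "cylinder_chart p = cylinder_chart q"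
  show "p = q"
  proof (cases "p = 0 \<or> q = 0")
    case True
    then show ?thesis using eq by (auto simp: cylinder_chart_def split: if_splits)
  next
    case False
    then have "upper_log p - upper_log q \<in> \<int>"
      using eq by (auto simp: cylinder_chart_def coset_Ints_eq_iff)
    then obtain n where "upper_log p - upper_log q = of_int n" by (auto elim: Ints_cases)
    then have "Ln p = Ln q + of_int n * (2 * of_real pi * \<i>)"
      by (simp add: upper_log_def field_simps)
    then have "exp (Ln p) = exp (Ln q)" by (auto simp: exp_eq algebra_simps)
    then show ?thesis using False by simp
  qed
qed

lemma cylinder_chart_exp: "cylinder_chart (exp (2 * of_real pi * \<i> * w)) = Fin (coset \<int> w)"
  by (simp add: cylinder_chart_def coset_Ints_eq_iff upper_log_exp)

text \<open>The chart \<open>exp (2\<pi>iz)\<close> covers the whole cylinder, so a holomorphic map into the cylinder is a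
  holomorphic function without zeros, and its logarithm on a convex set is the lift.\<close>

lemma holomorphic_lift_to_plane:
  assumes M: "holomorphic_map M compact_cylinder \<phi>"
    and U: "convex U" "open U"
    and loc: "\<And>z0. z0 \<in> U \<Longrightarrow> \<exists>D \<sigma>'. (D, \<sigma>') \<in> params M \<and> open D \<and> z0 \<in> D \<and> D \<subseteq> U \<and> (\<forall>z\<in>D. \<sigma>' z = \<sigma> z)"
    and fin: "\<And>z. z \<in> U \<Longrightarrow> \<exists>w. \<phi> (\<sigma> z) = Fin (coset \<int> w)"
  obtains \<Phi> where "\<Phi> holomorphic_on U" "\<And>z. z \<in> U \<Longrightarrow> \<phi> (\<sigma> z) = Fin (coset \<int> (\<Phi> z))"
proof -
  define q where "q z = inv cylinder_chart (\<phi> (\<sigma> z))" for z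
  have q_exp: "\<exists>w. \<phi> (\<sigma> z) = Fin (coset \<int> w) \<and> q z = exp (2 * of_real pi * \<i> * w)" if "z \<in> U" for z
    using fin[OF that] cylinder_chart_exp inv_f_f[OF inj_cylinder_chart] unfolding q_def by metis
  have chart: "(UNIV, cylinder_chart) \<in> params compact_cylinder"
    by (simp add: compact_cylinder_def cylinder_chart_def[abs_def])
  have "q holomorphic_on U"
  proof (rule holomorphic_onI)
    fix z0 assume "z0 \<in> U"
    then obtain D \<sigma>' where D: "(D, \<sigma>') \<in> params M" "open D" "z0 \<in> D" "D \<subseteq> U"
      and eq: "\<forall>z\<in>D. \<sigma>' z = \<sigma> z" using loc by blast
    have "(\<lambda>z. inv cylinder_chart (\<phi> (\<sigma>' z))) holomorphic_on {z \<in> D. \<phi> (\<sigma>' z) \<in> range cylinder_chart}"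
      using M D(1) chart unfolding holomorphic_map_def by fast
    moreover have "{z \<in> D. \<phi> (\<sigma>' z) \<in> range cylinder_chart} = D"
      using D(4) eq fin cylinder_chart_exp by (auto simp: image_iff) (metis subsetD)
    ultimately have "q holomorphic_on D"
      by (auto intro: holomorphic_transform simp: q_def eq)
    then show "q field_differentiable at z0 within U"
      using D holomorphic_on_imp_differentiable_at field_differentiable_at_within by blast
  qed
  moreover have "q z \<noteq> 0" if "z \<in> U" for z using q_exp[OF that] by auto
  ultimately obtain g where g: "g holomorphic_on U" "\<forall>z\<in>U. q z = exp (g z)"
    using simply_connected_eq_holomorphic_log[OF U(2)] convex_imp_simply_connected[OF U(1)] by blast
  show ?thesis
  proof (rule that[of "\<lambda>z. g z / (2 * of_real pi * \<i>)"])
    show "(\<lambda>z. g z / (2 * of_real pi * \<i>)) holomorphic_on U"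
      by (intro holomorphic_intros g) auto
    fix z assume z: "z \<in> U"
    obtain w where w: "\<phi> (\<sigma> z) = Fin (coset \<int> w)" "q z = exp (2 * of_real pi * \<i> * w)"
      using q_exp[OF z] by blast
    have "Fin (coset \<int> w) = cylinder_chart (exp (g z))" using w g z cylinder_chart_exp by metis
    also have "g z = 2 * of_real pi * \<i> * (g z / (2 * of_real pi * \<i>))" by simp
    also have "cylinder_chart (exp \<dots>) = Fin (coset \<int> (g z / (2 * of_real pi * \<i>)))"
      by (rule cylinder_chart_exp)
    finally show "\<phi> (\<sigma> z) = Fin (coset \<int> (g z / (2 * of_real pi * \<i>)))" using w by simp
  qed
qed
section \<open>Asymptotics at the ends of the cylinder\<close>

lemma infdist_Ints_attained:
  obtains n where "n \<in> \<int>" "infdist x \<int> = norm (x - n :: complex)"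
  using infdist_attains_inf[of \<int> x] closed_Ints by (metis Ints_0 dist_norm empty_iff)

lemma infdist_Ints_le:
  assumes "n \<in> \<int>" shows "infdist x \<int> \<le> norm (x - n :: complex)"
  using infdist_le[OF assms, of x] by (simp add: dist_norm)

lemma infdist_Ints_cong:
  assumes "x - y \<in> \<int>" shows "infdist x \<int> = infdist (y :: complex) \<int>"
proof -
  have le: "infdist x \<int> \<le> infdist y \<int>" if xy: "x - y \<in> \<int>" for x y :: complex
  proof -
    obtain n where n: "n \<in> \<int>" "infdist y \<int> = norm (y - n)" by (rule infdist_Ints_attained)
    have "infdist x \<int> \<le> norm (x - (n + (x - y)))" using n xy by (intro infdist_Ints_le Ints_add)
    then show ?thesis using n by simp
  qed
  have "y - x \<in> \<int>" using assms Ints_minus by fastforce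
  then show ?thesis using le assms by (intro antisym)
qed

text \<open>Different integers have distance at least \<open>1\<close>, so the integer nearest to \<open>f z\<close> is a locally constant
  function of \<open>z\<close>.\<close>

lemma near_Ints_constant:
  fixes f :: "complex \<Rightarrow> complex"
  assumes "connected S" "continuous_on S f" and near: "\<And>z. z \<in> S \<Longrightarrow> infdist (f z) \<int> < 1 / 4"
  obtains N where "N \<in> \<int>" "\<And>z. z \<in> S \<Longrightarrow> norm (f z - N) = infdist (f z) \<int>"
proof (cases "S = {}")
  case True
  then show ?thesis using that[of 0] by auto
next
  case False
  have "\<forall>z. \<exists>n. n \<in> \<int> \<and> infdist (f z) \<int> = norm (f z - n)"
    using infdist_Ints_attained by metis
  then obtain n where n: "\<And>z. n z \<in> \<int>" "\<And>z. infdist (f z) \<int> = norm (f z - n z)" by metis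
  have "continuous_on S n"
    unfolding continuous_on_iff
  proof (intro ballI allI impI)
    fix z and e :: real assume z: "z \<in> S" and e: "0 < e"
    obtain d where d: "0 < d" "\<And>w. w \<in> S \<Longrightarrow> dist w z < d \<Longrightarrow> dist (f w) (f z) < 1 / 2"
      using assms(2) z unfolding continuous_on_iff by (metis half_gt_zero zero_less_one)
    have "n w = n z" if w: "w \<in> S" "dist w z < d" for w
    proof (rule ccontr)
      assume "n w \<noteq> n z"
      then have "1 \<le> norm (n w - n z)" using dist_Ints_ge_1 n by blast
      also have "n w - n z = (f w - f z) - (f w - n w) + (f z - n z)" by simp
      also have "norm \<dots> \<le> norm (f w - f z) + norm (f w - n w) + norm (f z - n z)"
        using norm_triangle_ineq[of "(f w - f z) - (f w - n w)" "f z - n z"]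
          norm_triangle_ineq4[of "f w - f z" "f w - n w"] by linarith
      also have "\<dots> < 1" using d(2)[OF w] near[OF z] near[OF w(1)] n(2) by (simp add: dist_norm)
      finally show False by simp
    qed
    then show "\<exists>d>0. \<forall>w\<in>S. dist w z < d \<longrightarrow> dist (n w) (n z) < e"
      using d(1) e by (intro exI[of _ d]) auto
  qed
  then obtain N where "\<And>z. z \<in> S \<Longrightarrow> n z = N"
    using Ints_valued_constant[where f = n, OF assms(1)] n(1) by blast
  then show ?thesis using that[of N] n False by (metis ex_in_conv)
qed

text \<open>An asymptotic expansion modulo \<open>\<int>\<close> becomes an honest one for a continuous lift, and the translation
  part \<open>z\<close> of the expansion forces the lift to commute with \<open>z \<mapsto> z + 1\<close>. The sets \<open>S R\<close> are
  neighbourhoods of one of the two ends, so both ends are treated together.\<close>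

lemma lift_asymptotics_at_end:
  fixes \<Phi> f :: "complex \<Rightarrow> complex" and S :: "real \<Rightarrow> complex set"
  assumes ev: "\<And>P. eventually P E \<longleftrightarrow> (\<exists>R. \<forall>z\<in>S R. P z)" 
    and S: "\<And>R. connected (S R)" "\<And>R z. z \<in> S R \<Longrightarrow> z + 1 \<in> S R" "\<And>R. S R \<noteq> {}"
    and U: "S R0 \<subseteq> U" "\<And>R R'. \<exists>R''. S R'' \<subseteq> S R \<inter> S R'"
    and \<Phi>: "continuous_on U \<Phi>" "\<And>z. z \<in> U \<Longrightarrow> \<Phi> (z + 1) = \<Phi> z + k" "k \<in> \<int>"
    and lim: "tends_to_0_mod_Ints (\<lambda>z. f z - z - c) E"
    and lift: "\<And>z. z \<in> U \<Longrightarrow> \<Phi> z - f z \<in> \<int>"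
  obtains N where "N \<in> \<int>" "((\<lambda>z. \<Phi> z - z) \<longlongrightarrow> c + N) E" "k = 1"
proof -
  have "eventually (\<lambda>z. infdist (f z - z - c) \<int> < 1/4) E"
    using lim unfolding tends_to_0_mod_Ints_def by (rule order_tendstoD) simp
  then obtain R1 where R1: "\<forall>z\<in>S R1. infdist (f z - z - c) \<int> < 1/4"
    using ev[THEN iffD1] by blast
  obtain R where "S R \<subseteq> S R1 \<inter> S R0" using U(2) by blast
  then have R: "S R \<subseteq> U" "\<And>z. z \<in> S R \<Longrightarrow> infdist (f z - z - c) \<int> < 1/4"
    using U(1) R1 by auto
  have same: "infdist (\<Phi> z - z - c) \<int> = infdist (f z - z - c) \<int>" if "z \<in> S R" for z
    using lift[of z] R that by (intro infdist_Ints_cong) auto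
  have cont: "continuous_on (S R) (\<lambda>z. \<Phi> z - z - c)"
    by (intro continuous_intros continuous_on_subset[OF \<Phi>(1)] R)
  obtain N where N: "N \<in> \<int>" "\<And>z. z \<in> S R \<Longrightarrow> norm (\<Phi> z - z - c - N) = infdist (\<Phi> z - z - c) \<int>"
    using near_Ints_constant[OF S(1) cont] same R by auto
  have evR: "eventually (\<lambda>z. z \<in> S R) E" using ev[of "\<lambda>z. z \<in> S R"] by blast
  have "((\<lambda>z. norm (\<Phi> z - z - c - N)) \<longlongrightarrow> 0) E"
    using lim unfolding tends_to_0_mod_Ints_def
    by (rule Lim_transform_eventually) (rule eventually_mono[OF evR], simp add: N same)
  then have lim': "((\<lambda>z. \<Phi> z - z - (c + N)) \<longlongrightarrow> 0) E"
    unfolding tendsto_norm_zero_iff by (simp add: algebra_simps)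
  obtain z where z: "z \<in> S R" using S(3) by blast
  have lt: "norm (\<Phi> w - w - c - N) < 1/4" if "w \<in> S R" for w using N R same that by simp
  \<comment> \<open>An integer at distance less than \<open>1\<close> from \<open>1\<close> is \<open>1\<close>.\<close>
  have "k - 1 = (\<Phi> (z + 1) - (z + 1) - c - N) - (\<Phi> z - z - c - N)"
    using \<Phi>(2)[of z] z R by auto
  then have "norm (k - 1) \<le> norm (\<Phi> (z + 1) - (z + 1) - c - N) + norm (\<Phi> z - z - c - N)"
    by (metis norm_triangle_ineq4)
  then have "norm (k - 1) < 1" using lt[OF z] lt[OF S(2)[OF z]] by linarith
  then have "k = 1" using dist_Ints_ge_1[of k 1] \<Phi>(3) by fastforce
  with N(1) LIM_zero_cancel[OF lim'] show ?thesis by (rule that)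
qed

lemma eventually_Im_at_top: "eventually P (filtercomap Im at_top) \<longleftrightarrow> (\<exists>R. \<forall>z\<in>{z. R < Im z}. P z)"
  by (simp add: eventually_filtercomap_at_top_dense)

lemma eventually_Im_at_bot: "eventually P (filtercomap Im at_bot) \<longleftrightarrow> (\<exists>R. \<forall>z\<in>{z. Im z < R}. P z)"
  by (simp add: eventually_filtercomap_at_bot_dense)

lemma deriv_near_1_if_near_translation:
  assumes "f holomorphic_on U" "open U" "cball z 1 \<subseteq> U"
    and near: "\<And>w. w \<in> cball z 1 \<Longrightarrow> norm (f w - w - c) \<le> d"
  shows "norm (deriv f z - 1) \<le> d"
proof -
  define g where "g w = f w - w - c" for w
  have hol: "g holomorphic_on U" unfolding g_def by (intro holomorphic_intros assms)
  have cont: "continuous_on (cball z 1) g"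
    using holomorphic_on_imp_continuous_on[OF holomorphic_on_subset[OF hol assms(3)]] .
  have "g holomorphic_on ball z 1"
    using holomorphic_on_subset[OF hol] assms(3) ball_subset_cball by blast
  from Cauchy_inequality[OF this cont, of d 1]
  have "norm ((deriv ^^ 1) g z) \<le> fact 1 * d / 1 ^ 1"
    using near by (simp add: g_def dist_norm)
  moreover have "deriv g z = deriv f z - 1"
  proof -
    have "(f has_field_derivative deriv f z) (at z)"
      using assms(3) by (intro holomorphic_derivI[OF assms(1,2)]) auto
    then have "(g has_field_derivative deriv f z - 1 - 0) (at z)"
      unfolding g_def[abs_def] by (intro derivative_intros)
    then show ?thesis using DERIV_imp_deriv by fastforce
  qed
  ultimately show ?thesis by simp
qed

section \<open>Charts across a seam\<close>

text \<open>A holomorphic extension \<open>G\<close> of the circle diffeomorphism to a strip, injective and mapping the lower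
  half of the strip below the real axis. It provides the charts across the seams of both glued surfaces.
  The width and height bounds by \<open>1\<close> keep the two ends of a seam chart apart in a tall annulus.\<close>

locale seam_extension =
  fixes F :: "real \<Rightarrow> real" and e :: real and G :: "complex \<Rightarrow> complex"
  assumes F: "analytic_circle_diffeo F"
    and e_pos: "0 < e" and e_le_1: "e \<le> 1"
    and G_holomorphic: "G holomorphic_on strip (-e) e"
    and G_inj: "inj_on G (strip (-e) e)"
    and G_real: "G (of_real x) = of_real (F x)"
    and G_add_int: "z \<in> strip (-e) e \<Longrightarrow> G (z + of_int k) = G z + of_int k"
    and G_lower: "z \<in> strip (-e) 0 \<Longrightarrow> G z \<in> strip (-1) 0"
begin

lemma G_Ints:
  assumes "z \<in> strip (-e) e" "w \<in> strip (-e) e" "G z - G w \<in> \<int>"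
  shows "z - w \<in> \<int>"
proof -
  obtain k where "G z = G w + of_int k" using assms(3) by (auto elim!: Ints_cases simp: algebra_simps)
  then have "G z = G (w + of_int k)" using G_add_int assms(2) by simp
  then have "z = w + of_int k" using G_inj assms by (auto dest!: inj_onD)
  then show ?thesis by simp
qed

lemma G_lower': "-e < Im z \<Longrightarrow> Im z < 0 \<Longrightarrow> Im (G z) < 0 \<and> -1 < Im (G z)"
  using G_lower[of z] by auto

end

lemma eq_in_ball_if_diff_Ints:
  assumes "z \<in> ball z0 r" "w \<in> ball z0 r" "r \<le> 1/2" "z - w \<in> \<int>"
  shows "z = (w :: complex)"
proof (rule ccontr)
  assume "z \<noteq> w"
  then have "1 \<le> dist z w" using dist_Ints_ge_1[of "z - w" 0] assms(4) by (simp add: dist_norm)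
  then show False
    using assms(1-3) dist_triangle2[of z w z0] by (auto simp: dist_commute)
qed

lemma Im_eq_if_diff_Ints: "z - w \<in> \<int> \<Longrightarrow> Im z = Im w"
  by (metis Ints_cases Im_complex_of_real complex_eq_iff
        diff_add_cancel plus_complex.sel(2) add_0 of_real_of_int_eq)

lemma continuous_on_translation_difference:
  fixes f :: "complex \<Rightarrow> complex"
  assumes "continuous_on U f" "\<And>z. z \<in> U \<Longrightarrow> z + 1 \<in> U"
  shows "continuous_on U (\<lambda>z. f (z + 1) - f z)"
  by (rule continuous_on_diff[OF continuous_on_compose2[OF assms(1)] assms(1)])
    (use assms(2) in \<open>auto intro!: continuous_intros\<close>)

lemma ball_Im:
  assumes "z \<in> ball z0 r" shows "Im z0 - r < Im z" "Im z < Im z0 + r"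
  using assms abs_Im_le_cmod[of "z0 - z"] by (auto simp: dist_norm)

context seam_extension
begin

text \<open>A disc meeting the seam parametrizes the glued surface as soon as it is too small to contain two
  points that differ by an integer.\<close>

lemma ball_in_seam_params:
  assumes z0: "-e < Im z0" "Im z0 \<le> 0"
    and r: "r \<le> e + Im z0" "r \<le> 1/2"
    and A: "\<And>z. 0 \<le> Im z \<Longrightarrow> Im z < e \<Longrightarrow> z \<in> A"
    and B: "\<And>z. -1 < Im z \<Longrightarrow> Im z < 0 \<Longrightarrow> z \<in> B"
    and P: "\<And>z w. z \<in> A \<Longrightarrow> w \<in> A \<Longrightarrow> P z = P w \<Longrightarrow> z - w \<in> \<int>"
    and Q: "\<And>z w. z \<in> B \<Longrightarrow> w \<in> B \<Longrightarrow> Q z = Q w \<Longrightarrow> z - w \<in> \<int>"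
    and PQ: "\<And>z w. 0 \<le> Im z \<Longrightarrow> Im z < e \<Longrightarrow> -1 < Im w \<Longrightarrow> Im w < 0 \<Longrightarrow> P z \<noteq> Q w"
  shows "(ball z0 r, \<lambda>z. if 0 \<le> Im z then P z else Q (G z)) \<in> seam_params F A P B Q"
proof -
  let ?\<sigma> = "\<lambda>z. if 0 \<le> Im z then P z else Q (G z)"
  have strip: "z \<in> strip (-e) e" if "z \<in> ball z0 r" for z
    using ball_Im[OF that] z0 r by auto
  have PQ': "P z \<noteq> Q (G w)"
    if "z \<in> ball z0 r" "w \<in> ball z0 r" "0 \<le> Im z" "\<not> 0 \<le> Im w" for z w
    using that PQ[of z "G w"] strip[of z] strip[of w] G_lower'[of w] by auto
  have "inj_on ?\<sigma> (ball z0 r)"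
  proof (rule inj_onI)
    fix z w assume zw: "z \<in> ball z0 r" "w \<in> ball z0 r" and eq: "?\<sigma> z = ?\<sigma> w"
    have "z - w \<in> \<int>"
    proof (cases "0 \<le> Im z"; cases "0 \<le> Im w")
      assume "0 \<le> Im z" "0 \<le> Im w"
      then show ?thesis using eq P[of z w] A strip[OF zw(1)] strip[OF zw(2)] by auto
    next
      assume "\<not> 0 \<le> Im z" "\<not> 0 \<le> Im w"
      then have "G z - G w \<in> \<int>"
        using eq strip[OF zw(1)] strip[OF zw(2)] G_lower'[of z] G_lower'[of w] B
        by (intro Q) auto
      then show ?thesis using G_Ints strip zw by blast
    next
      assume "0 \<le> Im z" "\<not> 0 \<le> Im w"
      then show ?thesis using eq PQ'[OF zw] by simp
    next
      assume "\<not> 0 \<le> Im z" "0 \<le> Im w"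
      then show ?thesis using eq PQ'[OF zw(2,1)] by simp
    qed
    then show "z = w" using eq_in_ball_if_diff_Ints zw r by blast
  qed
  moreover have "G holomorphic_on ball z0 r"
    using G_holomorphic by (rule holomorphic_on_subset) (use strip in blast)
  moreover have "\<forall>z\<in>ball z0 r. if 0 \<le> Im z then z \<in> A else G z \<in> B"
    using strip G_lower' A B by auto
  ultimately show ?thesis
    unfolding seam_params_def using G_real by blast
qed
section \<open>The welding isomorphism in plane coordinates\<close>

lemma weld_upper_eq_iff:
  assumes "0 \<le> Im z" "0 \<le> Im w"
  shows "weld_upper F z = weld_upper F w \<longleftrightarrow> z - w \<in> \<int>"
proof -
  have "Inl z \<in> closed_half_planes" "Inl w \<in> closed_half_planes"
    using assms by (auto simp: closed_half_planes_def)
  then show ?thesis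
    using eq_equiv_class_iff[OF equiv_weld_rel[OF F]]
    by (simp add: weld_upper_def) (simp add: weld_rel_def)
qed

lemma weld_lower_eq_iff:
  assumes "Im z \<le> 0" "Im w \<le> 0"
  shows "weld_lower F z = weld_lower F w \<longleftrightarrow> z - w \<in> \<int>"
proof -
  have "Inr z \<in> closed_half_planes" "Inr w \<in> closed_half_planes"
    using assms by (auto simp: closed_half_planes_def)
  then show ?thesis
    using eq_equiv_class_iff[OF equiv_weld_rel[OF F]]
    by (simp add: weld_lower_def) (simp add: weld_rel_def)
qed

lemma weld_upper_neq_weld_lower:
  assumes "0 \<le> Im z" "Im w < 0"
  shows "weld_upper F z \<noteq> weld_lower F w"
proof
  assume eq: "weld_upper F z = weld_lower F w"
  have "Inl z \<in> closed_half_planes" "Inr w \<in> closed_half_planes"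
    using assms by (auto simp: closed_half_planes_def)
  then have "weld_identified F (Inl z) (Inr w)"
    using eq eq_equiv_class_iff[OF equiv_weld_rel[OF F]]
    by (simp add: weld_upper_def weld_lower_def) (simp add: weld_rel_def)
  then show False using assms Im_eq_if_diff_Ints by fastforce
qed

lemma weld_upper_in_points: "0 \<le> Im z \<Longrightarrow> weld_upper F z \<in> points (welded_sphere F)"
  by (auto simp: welded_sphere_def weld_upper_def closed_half_planes_def intro!: quotientI imageI)

lemma weld_lower_in_points: "Im z \<le> 0 \<Longrightarrow> weld_lower F z \<in> points (welded_sphere F)"
  by (auto simp: welded_sphere_def weld_lower_def closed_half_planes_def intro!: quotientI imageI)

text \<open>The upper half-plane, continued a little below the real axis into the lower half of the sphere.\<close>

definition across_seam :: "complex \<Rightarrow> (complex + complex) set with_ends" where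
  "across_seam z = (if 0 \<le> Im z then weld_upper F z else weld_lower F (G z))"

lemma across_seam_chart:
  assumes "-e < Im z0"
  shows "\<exists>D \<sigma>. (D, \<sigma>) \<in> params (welded_sphere F) \<and> open D \<and> z0 \<in> D \<and> D \<subseteq> {z. -e < Im z} \<and>
    (\<forall>z\<in>D. \<sigma> z = across_seam z)"
proof (cases "0 < Im z0")
  case True
  define r where "r = min (Im z0) (1/2)"
  have up: "0 < Im z" if "z \<in> ball z0 r" for z using ball_Im[OF that] by (simp add: r_def)
  have "inj_on (weld_upper F) (ball z0 r)"
  proof (rule inj_onI)
    fix z w assume "z \<in> ball z0 r" "w \<in> ball z0 r" "weld_upper F z = weld_upper F w"
    then show "z = w"
      using up[of z] up[of w] weld_upper_eq_iff[of z w] eq_in_ball_if_diff_Ints[of z z0 r w]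
      by (simp add: r_def)
  qed
  then have "(ball z0 r, weld_upper F) \<in> params (welded_sphere F)"
    using up by (auto simp: welded_sphere_def)
  then show ?thesis
    using True up e_pos
    by (intro exI[of _ "ball z0 r"] exI[of _ "weld_upper F"])
      (fastforce simp: across_seam_def r_def less_imp_le)
next
  case False
  define r where "r = min (e + Im z0) (1/2)"
  have r: "r \<le> e + Im z0" "r \<le> 1/2" unfolding r_def by linarith+
  have "(ball z0 r, \<lambda>z. if 0 \<le> Im z then weld_upper F z else weld_lower F (G z))
      \<in> seam_params F {z. 0 \<le> Im z} (weld_upper F) {w. Im w < 0} (weld_lower F)"
    by (rule ball_in_seam_params[OF assms _ r])
      (use False weld_upper_eq_iff weld_lower_eq_iff weld_upper_neq_weld_lower in auto)
  then have "(ball z0 r, across_seam) \<in> params (welded_sphere F)"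
    by (simp add: welded_sphere_def across_seam_def[abs_def])
  moreover have "ball z0 r \<subseteq> {z. -e < Im z}" using ball_Im False by (fastforce simp: r_def)
  ultimately show ?thesis
    using assms by (intro exI[of _ "ball z0 r"] exI[of _ across_seam]) (auto simp: r_def)
qed

lemma weld_lower_chart:
  assumes "Im z0 < 0"
  shows "\<exists>D \<sigma>. (D, \<sigma>) \<in> params (welded_sphere F) \<and> open D \<and> z0 \<in> D \<and> D \<subseteq> {z. Im z < 0} \<and>
    (\<forall>z\<in>D. \<sigma> z = weld_lower F z)"
proof -
  define r where "r = min (- Im z0) (1/2)"
  have lo: "Im z < 0" if "z \<in> ball z0 r" for z using ball_Im[OF that] by (simp add: r_def)
  have "inj_on (weld_lower F) (ball z0 r)"
  proof (rule inj_onI)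
    fix z w assume "z \<in> ball z0 r" "w \<in> ball z0 r" "weld_lower F z = weld_lower F w"
    then show "z = w"
      using lo[of z] lo[of w] weld_lower_eq_iff[of z w] eq_in_ball_if_diff_Ints[of z z0 r w]
      by (simp add: r_def)
  qed
  then have "(ball z0 r, weld_lower F) \<in> params (welded_sphere F)"
    using lo by (auto simp: welded_sphere_def)
  then show ?thesis
    using assms lo by (intro exI[of _ "ball z0 r"] exI[of _ "weld_lower F"]) (auto simp: r_def)
qed

text \<open>The two restrictions of the welding isomorphism lift to half-planes. On the common part their
  difference is an integer, which is absorbed into \<open>\<Phi>m\<close>; the difference \<open>A - B\<close> of the translation
  parts at the two ends only changes by integers in the process.\<close>

lemma welding_maps:
  assumes C: "has_welding_constant F C"
  obtains \<Phi>p \<Phi>m A B where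
    "\<Phi>p holomorphic_on {z. -e < Im z}" "\<Phi>m holomorphic_on {z. Im z < 0}"
    "\<And>z. -e < Im z \<Longrightarrow> \<Phi>p (z + 1) = \<Phi>p z + 1" "\<And>z. Im z < 0 \<Longrightarrow> \<Phi>m (z + 1) = \<Phi>m z + 1"
    "\<And>z. z \<in> strip (-e) 0 \<Longrightarrow> \<Phi>m (G z) = \<Phi>p z"
    "((\<lambda>z. \<Phi>p z - z) \<longlongrightarrow> A) (filtercomap Im at_top)"
    "((\<lambda>z. \<Phi>m z - z) \<longlongrightarrow> B) (filtercomap Im at_bot)"
    "C - (A - B) \<in> \<int>"
proof -
  obtain \<phi> \<phi>p \<phi>m Cp Cm where
    bi: "biholomorphic_map (welded_sphere F) compact_cylinder \<phi>" and
    ends: "\<phi> PlusInf = PlusInf" "\<phi> MinusInf = MinusInf" and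
    \<phi>p: "\<And>z. 0 < Im z \<Longrightarrow> \<phi> (weld_upper F z) = Fin (coset \<int> (\<phi>p z))" and
    \<phi>m: "\<And>w. Im w < 0 \<Longrightarrow> \<phi> (weld_lower F w) = Fin (coset \<int> (\<phi>m w))" and
    lim_p: "tends_to_0_mod_Ints (\<lambda>z. \<phi>p z - z - Cp) (filtercomap Im at_top)" and
    lim_m: "tends_to_0_mod_Ints (\<lambda>w. \<phi>m w - w - Cm) (filtercomap Im at_bot)" and
    C: "C - (Cp - Cm) \<in> \<int>"
    using C unfolding has_welding_constant_def by blast
  have hol: "holomorphic_map (welded_sphere F) compact_cylinder \<phi>"
    using bi by (simp add: biholomorphic_map_def)
  have bij: "bij_betw \<phi> (points (welded_sphere F)) (points compact_cylinder)"
    using bi by (simp add: biholomorphic_map_def)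
  have fin: "\<exists>w. \<phi> (Fin p) = Fin (coset \<int> w)" if "Fin p \<in> points (welded_sphere F)" for p
  proof -
    have "PlusInf \<in> points (welded_sphere F)" "MinusInf \<in> points (welded_sphere F)"
      by (simp_all add: welded_sphere_def)
    then have "\<phi> (Fin p) \<noteq> PlusInf" "\<phi> (Fin p) \<noteq> MinusInf"
      using bij_betw_imp_inj_on[OF bij] that ends by (metis inj_onD with_ends.distinct(1,3))+
    moreover have "\<phi> (Fin p) \<in> points compact_cylinder" using bij that bij_betwE by blast
    ultimately show ?thesis by (auto simp: compact_cylinder_def)
  qed
  have fin_p: "\<exists>w. \<phi> (across_seam z) = Fin (coset \<int> w)" if "z \<in> {z. -e < Im z}" for z
    using that fin weld_upper_in_points[of z] weld_lower_in_points[of "G z"] G_lower'[of z]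
    unfolding across_seam_def weld_upper_def weld_lower_def by (auto simp: less_imp_le)
  have fin_m: "\<exists>w. \<phi> (weld_lower F z) = Fin (coset \<int> w)" if "z \<in> {z. Im z < 0}" for z
    using that \<phi>m by blast
  obtain \<Phi>p where p: "\<Phi>p holomorphic_on {z. -e < Im z}"
    and p_lift: "\<And>z. z \<in> {z. -e < Im z} \<Longrightarrow> \<phi> (across_seam z) = Fin (coset \<int> (\<Phi>p z))"
    using holomorphic_lift_to_plane[OF hol convex_halfspace_Im_gt open_halfspace_Im_gt
        across_seam_chart fin_p] by blast
  obtain \<Phi>m where m: "\<Phi>m holomorphic_on {z. Im z < 0}"
    and m_lift: "\<And>z. z \<in> {z. Im z < 0} \<Longrightarrow> \<phi> (weld_lower F z) = Fin (coset \<int> (\<Phi>m z))"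
    using holomorphic_lift_to_plane[OF hol convex_halfspace_Im_lt open_halfspace_Im_lt
        weld_lower_chart fin_m] by blast
  have conn: "connected {z. a < Im z}" "connected {z. Im z < a}" for a
    by (simp_all add: convex_connected convex_halfspace_Im_gt convex_halfspace_Im_lt)
  have cont_p: "continuous_on {z. -e < Im z} \<Phi>p" and cont_m: "continuous_on {z. Im z < 0} \<Phi>m"
    using p m holomorphic_on_imp_continuous_on by blast+
  have p_per: "\<Phi>p (z + 1) - \<Phi>p z \<in> \<int>" if "z \<in> {z. -e < Im z}" for z
  proof -
    have "across_seam (z + 1) = across_seam z"
    proof (cases "0 \<le> Im z")
      case True
      then show ?thesis by (simp add: across_seam_def weld_upper_eq_iff)
    next
      case False
      moreover have "G (z + 1) = G z + 1" using G_add_int[of z 1] False that e_pos by simp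
      ultimately show ?thesis using that G_lower'[of z] by (simp add: across_seam_def weld_lower_eq_iff)
    qed
    then show ?thesis
      using p_lift[of z] p_lift[of "z + 1"] that coset_Ints_eq_iff[of "\<Phi>p (z + 1)" "\<Phi>p z"] by simp
  qed
  have m_per: "\<Phi>m (z + 1) - \<Phi>m z \<in> \<int>" if "z \<in> {z. Im z < 0}" for z
  proof -
    have "weld_lower F (z + 1) = weld_lower F z" using that by (simp add: weld_lower_eq_iff)
    then show ?thesis
      using m_lift[of z] m_lift[of "z + 1"] that coset_Ints_eq_iff[of "\<Phi>m (z + 1)" "\<Phi>m z"] by simp
  qed
  have "continuous_on {z. -e < Im z} (\<lambda>z. \<Phi>p (z + 1) - \<Phi>p z)"
    by (rule continuous_on_translation_difference[OF cont_p]) simp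
  then have "\<exists>c. \<forall>z\<in>{z. -e < Im z}. \<Phi>p (z + 1) - \<Phi>p z = c"
    by (rule Ints_valued_constant[OF conn(1)]) (rule p_per)
  then obtain kp where kp: "\<And>z. z \<in> {z. -e < Im z} \<Longrightarrow> \<Phi>p (z + 1) - \<Phi>p z = kp"
    by blast
  have "continuous_on {z. Im z < 0} (\<lambda>z. \<Phi>m (z + 1) - \<Phi>m z)"
    by (rule continuous_on_translation_difference[OF cont_m]) simp
  then have "\<exists>c. \<forall>z\<in>{z. Im z < 0}. \<Phi>m (z + 1) - \<Phi>m z = c"
    by (rule Ints_valued_constant[OF conn(2)]) (rule m_per)
  then obtain km where km: "\<And>z. z \<in> {z. Im z < 0} \<Longrightarrow> \<Phi>m (z + 1) - \<Phi>m z = km"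
    by blast
  have kp1: "\<Phi>p (z + 1) = \<Phi>p z + kp" if "z \<in> {z. 0 < Im z}" for z
    using kp[of z] that e_pos by (auto simp: algebra_simps)
  have km1: "\<Phi>m (z + 1) = \<Phi>m z + km" if "z \<in> {z. Im z < 0}" for z
    using km[of z] that by (auto simp: algebra_simps)
  have kpI: "kp \<in> \<int>" using p_per[of 0] kp[of 0] e_pos by simp
  have kmI: "km \<in> \<int>" using m_per[of "- \<i>"] km[of "- \<i>"] by simp
  have lift_p: "\<Phi>p z - \<phi>p z \<in> \<int>" if "z \<in> {z. 0 < Im z}" for z
    using p_lift[of z] \<phi>p[of z] that e_pos coset_Ints_eq_iff[of "\<Phi>p z" "\<phi>p z"]
    by (simp add: across_seam_def)
  have lift_m: "\<Phi>m z - \<phi>m z \<in> \<int>" if "z \<in> {z. Im z < 0}" for z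
    using m_lift[of z] \<phi>m[of z] that coset_Ints_eq_iff[of "\<Phi>m z" "\<phi>m z"] by simp
  have ne: "{z. R < Im z} \<noteq> {}" "{z. Im z < R} \<noteq> {}" for R
    by (auto intro: exI[of _ "of_real (R + 1) * \<i>"] exI[of _ "of_real (R - 1) * \<i>"])
  obtain Np where Np: "Np \<in> \<int>" "((\<lambda>z. \<Phi>p z - z) \<longlongrightarrow> Cp + Np) (filtercomap Im at_top)" "kp = 1"
  proof (rule lift_asymptotics_at_end[OF eventually_Im_at_top conn(1) _ ne(1), of 0 "{z. 0 < Im z}"])
    show "\<exists>R''. {z. R'' < Im z} \<subseteq> {z. R < Im z} \<inter> {z. R' < Im z}" for R R'
      by (intro exI[of _ "max R R'"]) auto
    show "continuous_on {z. 0 < Im z} \<Phi>p"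
      by (rule continuous_on_subset[OF cont_p]) (use e_pos in auto)
  qed (use kp1 kpI lim_p lift_p in auto)
  obtain Nm where Nm: "Nm \<in> \<int>" "((\<lambda>z. \<Phi>m z - z) \<longlongrightarrow> Cm + Nm) (filtercomap Im at_bot)" "km = 1"
  proof (rule lift_asymptotics_at_end[OF eventually_Im_at_bot conn(2) _ ne(2), of 0 "{z. Im z < 0}"])
    show "\<exists>R''. {z. Im z < R''} \<subseteq> {z. Im z < R} \<inter> {z. Im z < R'}" for R R'
      by (intro exI[of _ "min R R'"]) auto
  qed (use km1 kmI lim_m lift_m cont_m in auto)
  have seam: "\<Phi>m (G z) - \<Phi>p z \<in> \<int>" if "z \<in> strip (-e) 0" for z
    using p_lift[of z] m_lift[of "G z"] that G_lower[OF that] coset_Ints_eq_iff[of "\<Phi>m (G z)" "\<Phi>p z"]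
    by (simp add: across_seam_def)
  have "continuous_on (strip (-e) 0) (\<lambda>z. \<Phi>m (G z) - \<Phi>p z)"
  proof (rule continuous_on_diff)
    show "continuous_on (strip (-e) 0) (\<lambda>z. \<Phi>m (G z))"
      by (rule continuous_on_compose2[OF cont_m
            continuous_on_subset[OF holomorphic_on_imp_continuous_on[OF G_holomorphic]]])
        (use G_lower e_pos in auto)
    show "continuous_on (strip (-e) 0) \<Phi>p"
      by (rule continuous_on_subset[OF cont_p]) auto
  qed
  then have "\<exists>c. \<forall>z\<in>strip (-e) 0. \<Phi>m (G z) - \<Phi>p z = c"
    by (rule Ints_valued_constant[OF convex_connected[OF convex_strip]]) (rule seam)
  then obtain k where k: "\<And>z. z \<in> strip (-e) 0 \<Longrightarrow> \<Phi>m (G z) - \<Phi>p z = k"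
    by blast
  have kI: "k \<in> \<int>"
  proof -
    have "- (of_real (e/2) * \<i>) \<in> strip (-e) 0" using e_pos by simp
    then show ?thesis using k seam by metis
  qed
  show ?thesis
  proof (rule that[of \<Phi>p "\<lambda>z. \<Phi>m z - k" "Cp + Np" "Cm + Nm - k"])
    show "(\<lambda>z. \<Phi>m z - k) holomorphic_on {z. Im z < 0}" by (intro holomorphic_intros m)
    show "\<Phi>p (z + 1) = \<Phi>p z + 1" if "-e < Im z" for z
      using kp[of z] Np that by (simp add: algebra_simps)
    show "\<Phi>m (z + 1) - k = \<Phi>m z - k + 1" if "Im z < 0" for z
      using km[of z] Nm that by (simp add: algebra_simps)
    show "\<Phi>m (G z) - k = \<Phi>p z" if "z \<in> strip (-e) 0" for z
      using k[OF that] by (simp add: algebra_simps)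
    have "((\<lambda>z. \<Phi>m z - z - k) \<longlongrightarrow> Cm + Nm - k) (filtercomap Im at_bot)"
      by (intro tendsto_intros Nm)
    then show "((\<lambda>z. \<Phi>m z - k - z) \<longlongrightarrow> Cm + Nm - k) (filtercomap Im at_bot)"
      by (simp add: algebra_simps)
    have "C - (Cp - Cm) - Np + Nm - k \<in> \<int>" using C Np Nm kI by simp
    then show "C - (Cp + Np - (Cm + Nm - k)) \<in> \<int>" by (simp add: algebra_simps)
  qed (use p Np in auto)
qed

end
section \<open>Lifting maps from a torus to the plane\<close>

lemma period_lattice_diff: "x \<in> period_lattice \<tau> \<Longrightarrow> y \<in> period_lattice \<tau> \<Longrightarrow> x - y \<in> period_lattice \<tau>"
proof -
  assume "x \<in> period_lattice \<tau>" "y \<in> period_lattice \<tau>"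
  then obtain a b c d :: int where "x = of_int a + of_int b * \<tau>" "y = of_int c + of_int d * \<tau>"
    unfolding period_lattice_def by blast
  then have "x - y = of_int (a - c) + of_int (b - d) * \<tau>" by (simp add: algebra_simps)
  then show ?thesis unfolding period_lattice_def by blast
qed

lemma of_int_in_period_lattice: "of_int m \<in> period_lattice \<tau>"
  unfolding period_lattice_def by (intro CollectI exI[of _ m] exI[of _ 0]) simp

lemma Ints_subset_period_lattice: "\<int> \<subseteq> period_lattice \<tau>"
  using of_int_in_period_lattice by (auto elim!: Ints_cases)

lemma zero_in_period_lattice: "0 \<in> period_lattice \<tau>"
  using of_int_in_period_lattice[of 0] by simp

lemma generator_in_period_lattice: "\<tau> \<in> period_lattice \<tau>"
  unfolding period_lattice_def by (intro CollectI exI[of _ 0] exI[of _ 1]) simp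

lemma period_lattice_minus: "x \<in> period_lattice \<tau> \<Longrightarrow> - x \<in> period_lattice \<tau>"
  using period_lattice_diff[OF zero_in_period_lattice, of x] by simp

lemma period_lattice_add: "x \<in> period_lattice \<tau> \<Longrightarrow> y \<in> period_lattice \<tau> \<Longrightarrow> x + y \<in> period_lattice \<tau>"
  using period_lattice_diff[OF _ period_lattice_minus, of x \<tau> y] by simp

lemma period_lattice_int_mult: 
  assumes "x \<in> period_lattice \<tau>" shows "of_int n * x \<in> period_lattice \<tau>"
proof -
  obtain a b :: int where "x = of_int a + of_int b * \<tau>"
    using assms unfolding period_lattice_def by blast
  then have "of_int n * x = of_int (n * a) + of_int (n * b) * \<tau>" by (simp add: algebra_simps)
  then show ?thesis unfolding period_lattice_def by blast
qed

lemma period_lattice_subset: 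
  assumes "g \<in> period_lattice \<tau>" shows "period_lattice g \<subseteq> period_lattice \<tau>"
proof
  fix x assume "x \<in> period_lattice g"
  then obtain a b :: int where "x = of_int a + of_int b * g" unfolding period_lattice_def by blast
  then show "x \<in> period_lattice \<tau>"
    using period_lattice_add of_int_in_period_lattice period_lattice_int_mult[OF assms] by blast
qed

lemma coset_lattice_eq_iff: "coset (period_lattice \<tau>) z = coset (period_lattice \<tau>) w \<longleftrightarrow> z - w \<in> period_lattice \<tau>"
  by (rule coset_eq_iff[OF zero_in_period_lattice period_lattice_diff])

lemma period_lattice_separated:
  assumes "x \<in> period_lattice \<tau>" "y \<in> period_lattice \<tau>" "x \<noteq> y" "0 < Im \<tau>"
  shows "min 1 (Im \<tau>) \<le> norm (x - y)"
proof -
  obtain m n :: int where mn: "x - y = of_int m + of_int n * \<tau>"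
    using period_lattice_diff[OF assms(1,2)] unfolding period_lattice_def by blast
  show ?thesis
  proof (cases "n = 0")
    case True
    then have "m \<noteq> 0" using mn assms(3) by auto
    then have "1 \<le> \<bar>m\<bar>" by simp
    then have "1 \<le> norm (x - y)" using mn True by (simp flip: of_int_abs)
    then show ?thesis by simp
  next
    case False
    then have "1 \<le> \<bar>real_of_int n\<bar>" by linarith
    then have "Im \<tau> \<le> \<bar>real_of_int n\<bar> * Im \<tau>" using assms(4) by simp
    also have "\<dots> = \<bar>Im (x - y)\<bar>" using assms(4) unfolding mn by (simp add: abs_mult)
    also have "\<dots> \<le> norm (x - y)" by (rule abs_Im_le_cmod)
    finally show ?thesis by simp
  qed
qed

lemma openin_torus:
  "openin (surface_topology (torus \<tau>)) W \<longleftrightarrow> W \<subseteq> range (coset (period_lattice \<tau>)) \<and>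
     (\<forall>D. open D \<longrightarrow> inj_on (coset (period_lattice \<tau>)) D \<longrightarrow> open {z \<in> D. coset (period_lattice \<tau>) z \<in> W})"
  by (subst openin_surface_topology) (auto simp: torus_def)

text \<open>The set of all points is open, since its preimages are the domains of the parametrizations.\<close>

lemma topspace_surface_topology:
  assumes "\<And>D \<sigma>. (D, \<sigma>) \<in> params M \<Longrightarrow> open D" "\<And>D \<sigma> z. (D, \<sigma>) \<in> params M \<Longrightarrow> z \<in> D \<Longrightarrow> \<sigma> z \<in> points M"
  shows "topspace (surface_topology M) = points M"
proof -
  have "{z \<in> D. \<sigma> z \<in> points M} = D" if "(D, \<sigma>) \<in> params M" for D \<sigma>
    using assms(2)[OF that] by blast
  then have "openin (surface_topology M) (points M)"
    by (subst openin_surface_topology) (use assms(1) in auto)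
  moreover have "topspace (surface_topology M) \<subseteq> points M"
    using openin_topspace[of "surface_topology M"] openin_surface_topology[of M] assms(1) by blast
  ultimately show ?thesis using openin_subset by blast
qed

lemma topspace_torus: "topspace (surface_topology (torus \<tau>)) = range (coset (period_lattice \<tau>))"
  by (subst topspace_surface_topology) (auto simp: torus_def)

lemma openin_torus_image:
  assumes "open D"
  shows "openin (surface_topology (torus \<tau>)) (coset (period_lattice \<tau>) ` D)"
  unfolding openin_torus
proof (intro conjI allI impI)
  fix E :: "complex set" assume "open E"
  have "{z \<in> E. coset (period_lattice \<tau>) z \<in> coset (period_lattice \<tau>) ` D} = E \<inter> (\<Union>g\<in>period_lattice \<tau>. (+) g ` D)"
  proof (intro set_eqI iffI)
    fix z assume "z \<in> {z \<in> E. coset (period_lattice \<tau>) z \<in> coset (period_lattice \<tau>) ` D}"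
    then obtain w where w: "z \<in> E" "w \<in> D" "z - w \<in> period_lattice \<tau>" by (auto simp: coset_lattice_eq_iff)
    then have "z \<in> (+) (z - w) ` D" by (auto intro!: image_eqI[of _ _ w])
    then show "z \<in> E \<inter> (\<Union>g\<in>period_lattice \<tau>. (+) g ` D)" using w by blast
  next
    fix z assume "z \<in> E \<inter> (\<Union>g\<in>period_lattice \<tau>. (+) g ` D)"
    then obtain g w where w: "z \<in> E" "g \<in> period_lattice \<tau>" "w \<in> D" "z = g + w" by blast
    then have "coset (period_lattice \<tau>) z = coset (period_lattice \<tau>) w" by (simp add: coset_lattice_eq_iff)
    then show "z \<in> {z \<in> E. coset (period_lattice \<tau>) z \<in> coset (period_lattice \<tau>) ` D}" using w by blast
  qed
  then show "open {z \<in> E. coset (period_lattice \<tau>) z \<in> coset (period_lattice \<tau>) ` D}"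
    using \<open>open E\<close> assms by (simp add: open_Int open_UN open_translation)
qed auto

text \<open>Lattice points have distance at least \<open>min 1 (Im \<tau>)\<close>, so a disc of half this radius embeds in the
  torus, and the inverse of this embedding is the chart used for the lift.\<close>

lemma torus_local_lift:
  assumes hol: "holomorphic_map M (torus \<tau>) h" and \<tau>: "0 < Im \<tau>"
    and M: "\<And>D \<sigma>. (D, \<sigma>) \<in> params M \<Longrightarrow> open D" "\<And>D \<sigma> z. (D, \<sigma>) \<in> params M \<Longrightarrow> z \<in> D \<Longrightarrow> \<sigma> z \<in> points M"
    and h: "h ` points M \<subseteq> range (coset (period_lattice \<tau>))"
    and D: "(D, \<sigma>) \<in> params M" "z0 \<in> D"
  obtains r f where "0 < r" "ball z0 r \<subseteq> D" "f holomorphic_on ball z0 r"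
    "\<And>z. z \<in> ball z0 r \<Longrightarrow> h (\<sigma> z) = coset (period_lattice \<tau>) (f z)"
proof -
  let ?c = "coset (period_lattice \<tau>)"
  obtain p where p: "h (\<sigma> z0) = ?c p" using h M(2)[OF D] by blast
  define d where "d = min 1 (Im \<tau>)"
  define E where "E = ball p (d / 2)"
  have "0 < d" using \<tau> by (simp add: d_def)
  have inj: "inj_on ?c E"
  proof (rule inj_onI)
    fix z w assume zw: "z \<in> E" "w \<in> E" "?c z = ?c w"
    have "dist z w < d"
      using zw by (intro dist_triangle_half_l[of z p d w]) (simp_all add: E_def dist_commute)
    then have "norm (z - w) < d" by (simp add: dist_norm)
    then show "z = w"
      using period_lattice_separated[of "z - w" \<tau> 0] zw(3) \<tau> zero_in_period_lattice
      by (force simp: coset_lattice_eq_iff d_def)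
  qed
  then have E: "(E, ?c) \<in> params (torus \<tau>)" by (auto simp: torus_def E_def)
  have top: "topspace (surface_topology M) = points M"
    by (rule topspace_surface_topology) (use M in blast)+
  define W where "W = {z \<in> D. h (\<sigma> z) \<in> ?c ` E}"
  have "openin (surface_topology (torus \<tau>)) (?c ` E)"
    by (rule openin_torus_image) (simp add: E_def)
  then have "openin (surface_topology M) {x \<in> topspace (surface_topology M). h x \<in> ?c ` E}"
    using hol openin_continuous_map_preimage unfolding holomorphic_map_def by blast
  then have "openin (surface_topology M) {x \<in> points M. h x \<in> ?c ` E}"
    by (simp only: top)
  then have "open {z \<in> D. \<sigma> z \<in> {x \<in> points M. h x \<in> ?c ` E}}"
    using openin_surface_topology[of M, OF M(1)] D(1) by fastforce
  moreover have "{z \<in> D. \<sigma> z \<in> {x \<in> points M. h x \<in> ?c ` E}} = W"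
    using M(2)[OF D(1)] by (auto simp: W_def)
  ultimately have "open W" by simp
  moreover have "z0 \<in> W" using D(2) p \<open>0 < d\<close> by (auto simp: W_def E_def)
  ultimately obtain r where r: "0 < r" "ball z0 r \<subseteq> W" using openE by blast
  have holW: "(\<lambda>z. inv_into E ?c (h (\<sigma> z))) holomorphic_on W"
    using hol D(1) E unfolding holomorphic_map_def W_def by fast
  show ?thesis
  proof (rule that[OF r(1) _ holomorphic_on_subset[OF holW r(2)]])
    show "ball z0 r \<subseteq> D" using r(2) by (auto simp: W_def)
    show "h (\<sigma> z) = ?c (inv_into E ?c (h (\<sigma> z)))" if "z \<in> ball z0 r" for z
      using that r(2) by (intro f_inv_into_f[symmetric]) (auto simp: W_def)
  qed
qed

text \<open>Local lifts differ by locally constant functions, so their derivatives fit together to a function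
  on the convex set. A primitive of it is a lift up to a constant, by connectedness.\<close>

lemma holomorphic_lift_through_coset:
  assumes \<tau>: "0 < Im \<tau>" and U: "convex U" "open U"
    and loc: "\<And>z0. z0 \<in> U \<Longrightarrow> \<exists>r f. 0 < r \<and> ball z0 r \<subseteq> U \<and> f holomorphic_on ball z0 r \<and>
      (\<forall>z\<in>ball z0 r. k z = coset (period_lattice \<tau>) (f z))"
  obtains H where "H holomorphic_on U" "\<And>z. z \<in> U \<Longrightarrow> k z = coset (period_lattice \<tau>) (H z)"
proof (cases "U = {}")
  case True
  then show ?thesis using that[of "\<lambda>z. z"] by auto
next
  case False
  let ?c = "coset (period_lattice \<tau>)"
  obtain r f where r: "\<And>z0. z0 \<in> U \<Longrightarrow> 0 < r z0" and sub: "\<And>z0. z0 \<in> U \<Longrightarrow> ball z0 (r z0) \<subseteq> U"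
    and f: "\<And>z0. z0 \<in> U \<Longrightarrow> f z0 holomorphic_on ball z0 (r z0)"
    and kf: "\<And>z0 z. z0 \<in> U \<Longrightarrow> z \<in> ball z0 (r z0) \<Longrightarrow> k z = ?c (f z0 z)"
    using loc by metis
  have df: "(f a has_field_derivative deriv (f a) z) (at z)" if "a \<in> U" "z \<in> ball a (r a)" for a z
    using holomorphic_derivI[OF f[OF that(1)] open_ball that(2)] .
  have same: "deriv (f a) z = deriv (f b) z" 
    if ab: "a \<in> U" "b \<in> U" and z: "z \<in> ball a (r a)" "z \<in> ball b (r b)" for a b z
  proof -
    let ?W = "ball a (r a) \<inter> ball b (r b)"
    have "\<exists>c. \<forall>w\<in>?W. f a w - f b w = c"
    proof (rule discrete_valued_constant[of _ _ "period_lattice \<tau>" "min 1 (Im \<tau>)"])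
      show "connected ?W" by (intro convex_connected convex_Int) auto
      show "continuous_on ?W (\<lambda>w. f a w - f b w)"
        using holomorphic_on_imp_continuous_on[OF f[OF ab(1)]] holomorphic_on_imp_continuous_on[OF f[OF ab(2)]]
        by (auto intro: continuous_on_diff continuous_on_subset)
      have "f a w - f b w \<in> period_lattice \<tau>" if "w \<in> ?W" for w
        using kf[OF ab(1), of w] kf[OF ab(2), of w] that coset_lattice_eq_iff[of \<tau> "f a w" "f b w"] by simp
      then show "(\<lambda>w. f a w - f b w) ` ?W \<subseteq> period_lattice \<tau>" by blast
    qed (use \<tau> period_lattice_separated in auto)
    then obtain c where c: "\<And>w. w \<in> ?W \<Longrightarrow> c + f b w = f a w" by (metis diff_add_cancel)
    have "((\<lambda>w. c + f b w) has_field_derivative 0 + deriv (f b) z) (at z)"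
      by (intro derivative_intros df ab z)
    then have "(f a has_field_derivative 0 + deriv (f b) z) (at z)"
      by (rule has_field_derivative_transform_within_open[where S = ?W]) (use z c in auto)
    then show ?thesis by (simp add: DERIV_imp_deriv)
  qed
  \<comment> \<open>All local lifts at a point have the same derivative there, so the choice of lift is irrelevant.\<close>
  define d where "d z = deriv (f z) z" for z
  have d_loc: "d z = deriv (f a) z" if "a \<in> U" "z \<in> ball a (r a)" for a z
  proof -
    have "z \<in> U" using sub that by blast
    then show ?thesis using same[of z a z] that r by (simp add: d_def)
  qed
  have "d holomorphic_on U"
  proof (rule holomorphic_onI)
    fix a assume a: "a \<in> U"
    have "d holomorphic_on ball a (r a)"
      by (rule holomorphic_transform[OF holomorphic_deriv[OF f[OF a] open_ball]]) (simp add: d_loc[OF a])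
    then show "d field_differentiable at a within U"
      using r[OF a] holomorphic_on_imp_differentiable_at[of d "ball a (r a)" a] 
      by (auto intro: field_differentiable_at_within)
  qed
  then obtain H0 where H0: "\<And>z. z \<in> U \<Longrightarrow> (H0 has_field_derivative d z) (at z)"
    using holomorphic_convex_primitive'[OF U] at_within_open[OF _ U(2)] by metis
  have H0f: "H0 z - f a z = H0 w - f a w" if "a \<in> U" "z \<in> ball a (r a)" "w \<in> ball a (r a)" for a z w
  proof (rule equal_derivatives_imp_constant_difference[OF convex_ball open_ball _ df[OF that(1)] that(2,3)])
    fix u assume "u \<in> ball a (r a)"
    then show "(H0 has_field_derivative deriv (f a) u) (at u)"
      using H0[of u] d_loc[OF that(1)] sub[OF that(1)] by auto
  qed
  obtain z0 where z0: "z0 \<in> U" using False by blast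
  define H where "H z = H0 z - (H0 z0 - f z0 z0)" for z
  have "k z = ?c (H z)" if "z \<in> U" for z
  proof (rule connected_induction_simple[OF convex_connected[OF U(1)], where P = "\<lambda>z. k z = ?c (H z)" and a = z0])
    show "k z0 = ?c (H z0)" using kf[of z0 z0] r z0 by (simp add: H_def)
    fix a assume a: "a \<in> U"
    show "\<exists>T. openin (top_of_set U) T \<and> a \<in> T \<and>
        (\<forall>x\<in>T. \<forall>y\<in>T. k x = ?c (H x) \<longrightarrow> k y = ?c (H y))"
    proof (intro exI conjI ballI impI)
      show "openin (top_of_set U) (ball a (r a))" using sub[OF a] by (simp add: open_subset)
      show "a \<in> ball a (r a)" using r[OF a] by simp
      fix x y assume xy: "x \<in> ball a (r a)" "y \<in> ball a (r a)" "k x = ?c (H x)"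
      have "f a x - H x \<in> period_lattice \<tau>"
        using kf[OF a xy(1)] xy(3) coset_lattice_eq_iff[of \<tau> "f a x" "H x"] by simp
      moreover have "f a x - H x = f a y - H y"
        using H0f[OF a xy(1,2)] by (simp add: H_def algebra_simps)
      ultimately show "k y = ?c (H y)"
        using kf[OF a xy(2)] coset_lattice_eq_iff[of \<tau> "f a y" "H y"] by simp
    qed
  qed (use z0 that in auto)
  moreover have "H holomorphic_on U"
    unfolding H_def[abs_def] using H0 U(2)
    by (intro holomorphic_intros) (meson DERIV_imp_deriv field_differentiable_def holomorphic_on_open)
  ultimately show ?thesis using that by blast
qed
section \<open>Loops in a torus\<close>

lemma exp_2pi_i_eq_iff: "exp (2 * of_real pi * \<i> * a) = exp (2 * of_real pi * \<i> * b) \<longleftrightarrow> a - b \<in> \<int>"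
proof
  assume "exp (2 * of_real pi * \<i> * a) = exp (2 * of_real pi * \<i> * b)"
  then obtain n :: int where "2 * of_real pi * \<i> * a = 2 * of_real pi * \<i> * b + of_real (of_int (2 * n) * pi) * \<i>"
    unfolding exp_eq by blast
  then have "(2 * of_real pi * \<i>) * a = (2 * of_real pi * \<i>) * (b + of_int n)"
    by (simp add: algebra_simps)
  then have "a = b + of_int n" by (subst (asm) mult_left_cancel) auto
  then show "a - b \<in> \<int>" by simp
next
  assume "a - b \<in> \<int>"
  then obtain n where "a = b + of_int n" by (auto elim!: Ints_cases simp: algebra_simps)
  then have "2 * of_real pi * \<i> * a = 2 * of_real pi * \<i> * b + of_real (of_int (2 * n) * pi) * \<i>"
    by (simp add: algebra_simps)
  then show "exp (2 * of_real pi * \<i> * a) = exp (2 * of_real pi * \<i> * b)"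
    unfolding exp_eq by blast
qed

text \<open>The winding number of a loop around \<open>0\<close> is invariant under free homotopy: a continuous logarithm of
  the whole homotopy restricts to the given ones on the two sides, up to constants.\<close>

lemma increment_of_lift_homotopy_invariant:
  fixes q :: "real \<times> real \<Rightarrow> complex" and u v :: "real \<Rightarrow> complex"
  assumes q: "continuous_on ({0..1} \<times> {0..1}) q"
    and loop: "\<And>s. s \<in> {0..1} \<Longrightarrow> q (s, 0) = q (s, 1)"
    and nz: "\<And>x. x \<in> {0..1} \<times> {0..1} \<Longrightarrow> q x \<noteq> 0"
    and u: "continuous_on {0..1} u" "\<And>t. t \<in> {0..1} \<Longrightarrow> q (0, t) = exp (2 * of_real pi * \<i> * u t)"
    and v: "continuous_on {0..1} v" "\<And>t. t \<in> {0..1} \<Longrightarrow> q (1, t) = exp (2 * of_real pi * \<i> * v t)"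
  shows "u 1 - u 0 = v 1 - v 0"
proof -
  have "contractible ({0..1} \<times> {0..1} :: (real \<times> real) set)"
    by (intro convex_imp_contractible convex_Times) auto
  then obtain g where g: "continuous_on ({0..1} \<times> {0..1}) g" "\<And>x. x \<in> {0..1} \<times> {0..1} \<Longrightarrow> q x = exp (g x)"
    using continuous_logarithm_on_contractible[OF q] nz by metis
  define X where "X x = g x / (2 * of_real pi * \<i>)" for x
  have X: "continuous_on ({0..1} \<times> {0..1}) X"
    unfolding X_def by (intro continuous_intros g) auto
  have qX: "q x = exp (2 * of_real pi * \<i> * X x)" if "x \<in> {0..1} \<times> {0..1}" for x
    using g(2)[OF that] by (simp add: X_def)
  have conn: "connected {0..1 :: real}" by simp
  have ends: "X (s, 1) - X (s, 0) \<in> \<int>" if "s \<in> {0..1}" for s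
    using loop[OF that] qX[of "(s, 0)"] qX[of "(s, 1)"] that exp_2pi_i_eq_iff[of "X (s, 1)" "X (s, 0)"] by simp
  have "continuous_on {0..1} (\<lambda>s. X (s, 1) - X (s, 0))"
    by (intro continuous_on_diff continuous_on_compose2[OF X] continuous_intros) auto
  then have "\<exists>c. \<forall>s\<in>{0..1}. X (s, 1) - X (s, 0) = c"
    by (rule Ints_valued_constant[OF conn]) (rule ends)
  then have X01: "X (0, 1) - X (0, 0) = X (1, 1) - X (1, 0)" by fastforce
  have side: "w 1 - w 0 = X (s, 1) - X (s, 0)"
    if s: "s \<in> {0..1}" and w: "continuous_on {0..1} w" "\<And>t. t \<in> {0..1} \<Longrightarrow> q (s, t) = exp (2 * of_real pi * \<i> * w t)"
    for s w
  proof -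
    have I: "X (s, t) - w t \<in> \<int>" if "t \<in> {0..1}" for t
      using w(2)[OF that] qX[of "(s, t)"] s that exp_2pi_i_eq_iff[of "X (s, t)" "w t"] by simp
    have "continuous_on {0..1} (\<lambda>t. X (s, t) - w t)"
      by (intro continuous_on_diff continuous_on_compose2[OF X] continuous_intros w(1)) (use s in auto)
    then have "\<exists>c. \<forall>t\<in>{0..1}. X (s, t) - w t = c"
      by (rule Ints_valued_constant[OF conn]) (rule I)
    then have "X (s, 1) - w 1 = X (s, 0) - w 0" by fastforce
    then show ?thesis by (simp add: algebra_simps)
  qed
  show ?thesis using side[OF _ u] side[OF _ v] X01 by simp
qed

text \<open>A real linear form that is integral on the lattice induces a character of the torus into the
  unit circle, and its winding number along the loop is the increment of the form.\<close>

lemma torus_loop_period_coordinate: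
  fixes l :: "complex \<Rightarrow> real"
  assumes l: "continuous_on UNIV l" "\<And>x y. l (x - y) = l x - l y" "\<And>g. g \<in> period_lattice \<tau> \<Longrightarrow> l g \<in> \<int>"
    and u: "continuous_on {0..1} u"
    and hom: "homotopic_with (\<lambda>\<gamma>. \<gamma> 0 = \<gamma> 1) (top_of_set {0..1 :: real}) (surface_topology (torus \<tau>))
          (\<lambda>t. coset (period_lattice \<tau>) (u t)) (\<lambda>t. coset (period_lattice \<tau>) (of_real t))"
  shows "l (u 1 - u 0) = l 1"
proof -
  let ?c = "coset (period_lattice \<tau>)"
  define character where "character S = exp (2 * of_real pi * \<i> * of_real (l (SOME z. ?c z = S)))" for S
  have character: "character (?c z) = exp (2 * of_real pi * \<i> * of_real (l z))" for z
  proof -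
    have "?c (SOME w. ?c w = ?c z) = ?c z" by (rule someI[of _ z]) simp
    then have "l ((SOME w. ?c w = ?c z) - z) \<in> \<int>" using l(3) coset_lattice_eq_iff by blast
    then have "complex_of_real (l (SOME w. ?c w = ?c z)) - of_real (l z) \<in> \<int>"
      by (simp add: l(2) Ints_of_real flip: of_real_diff)
    then show ?thesis unfolding character_def exp_2pi_i_eq_iff .
  qed
  have character_cont: "continuous_map (surface_topology (torus \<tau>)) euclidean character"
    unfolding continuous_map_def topspace_torus
  proof (intro conjI allI impI)
    fix V :: "complex set" assume V: "openin euclidean V"
    have "open ((\<lambda>z. exp (2 * of_real pi * \<i> * of_real (l z))) -` V)"
      using V l(1) by (intro open_vimage continuous_intros) auto
    moreover have "{z \<in> D. ?c z \<in> {x \<in> range ?c. character x \<in> V}} = D \<inter> (\<lambda>z. exp (2 * of_real pi * \<i> * of_real (l z))) -` V"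
      for D
      using character by auto
    ultimately show "openin (surface_topology (torus \<tau>)) {x \<in> range ?c. character x \<in> V}"
      unfolding openin_torus by (auto intro: open_Int)
  qed auto
  obtain k where k: "continuous_map (prod_topology (top_of_set {0..1}) (top_of_set {0..1})) (surface_topology (torus \<tau>)) k"
    and k0: "\<And>t. k (0, t) = ?c (u t)" and k1: "\<And>t. k (1, t) = ?c (of_real t)"
    and loop: "\<And>s. s \<in> {0..1 :: real} \<Longrightarrow> k (s, 0) = k (s, 1)"
    using hom unfolding homotopic_with_def by blast
  have "continuous_map (top_of_set ({0..1} \<times> {0..1})) euclidean (character \<circ> k)"
    using continuous_map_compose[OF k character_cont] by (simp flip: subtopology_Times)
  then have cont: "continuous_on ({0..1} \<times> {0..1}) (character \<circ> k)" by simp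
  have "complex_of_real (l (u 1)) - of_real (l (u 0)) = of_real (l (of_real 1)) - of_real (l (of_real 0))"
  proof (rule increment_of_lift_homotopy_invariant[OF cont])
    show "continuous_on {0..1} (\<lambda>t. complex_of_real (l (u t)))" 
      "continuous_on {0..1} (\<lambda>t. complex_of_real (l (of_real t)))"
      by (intro continuous_intros continuous_on_compose2[OF l(1)] u; simp)+
  qed (auto simp: loop k0 k1 character, simp add: character_def)
  then have "complex_of_real (l (u 1) - l (u 0)) = of_real (l 1 - l 0)" by simp
  then have "l (u 1) - l (u 0) = l 1 - l 0" by (simp only: of_real_eq_iff)
  moreover have "l 0 = 0" using l(2)[of 0 0] by simp
  ultimately show ?thesis by (simp add: l(2))
qed

text \<open>The two coordinates of a point with respect to the basis \<open>1, \<tau>\<close> are integral on the lattice, and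
  together they determine the period.\<close>

lemma torus_loop_period:
  assumes \<tau>: "0 < Im \<tau>" and u: "continuous_on {0..1} u"
    and hom: "homotopic_with (\<lambda>\<gamma>. \<gamma> 0 = \<gamma> 1) (top_of_set {0..1 :: real}) (surface_topology (torus \<tau>))
          (\<lambda>t. coset (period_lattice \<tau>) (u t)) (\<lambda>t. coset (period_lattice \<tau>) (of_real t))"
  shows "u 1 - u 0 = 1"
proof -
  define b where "b z = Im z / Im \<tau>" for z
  define a where "a z = Re z - b z * Re \<tau>" for z
  have lat: "a (of_int m + of_int n * \<tau>) = of_int m" "b (of_int m + of_int n * \<tau>) = of_int n" for m n
    using \<tau> by (simp_all add: a_def b_def)
  have "a (u 1 - u 0) = a 1"
  proof (rule torus_loop_period_coordinate[OF _ _ _ u hom])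
    show "continuous_on UNIV a" unfolding a_def b_def by (intro continuous_intros) (use \<tau> in auto)
    show "a (x - y) = a x - a y" for x y by (simp add: a_def b_def algebra_simps diff_divide_distrib)
    show "a g \<in> \<int>" if "g \<in> period_lattice \<tau>" for g
      using that lat(1) unfolding period_lattice_def by auto
  qed
  moreover have "b (u 1 - u 0) = b 1"
  proof (rule torus_loop_period_coordinate[OF _ _ _ u hom])
    show "continuous_on UNIV b" unfolding b_def by (intro continuous_intros) (use \<tau> in auto)
    show "b (x - y) = b x - b y" for x y by (simp add: b_def diff_divide_distrib)
    show "b g \<in> \<int>" if "g \<in> period_lattice \<tau>" for g
      using that lat(2) unfolding period_lattice_def by auto
  qed
  ultimately show ?thesis using \<tau> by (simp add: a_def b_def complex_eq_iff)
qed

text \<open>The translates of \<open>T\<close> by \<open>\<Gamma>\<close> are open, cover the plane, and are equal to \<open>T\<close> or disjoint from it; the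
  plane is connected, so there is only one of them.\<close>

lemma open_set_with_disjoint_translates:
  fixes T :: "complex set"
  assumes "open T" "T \<noteq> {}"
    and cover: "\<And>p. \<exists>x\<in>T. p - x \<in> \<Gamma>"
    and translates: "\<And>x y g. x \<in> T \<Longrightarrow> y \<in> T \<Longrightarrow> g \<in> \<Gamma> \<Longrightarrow> x + g \<in> T \<Longrightarrow> y + g \<in> T"
  shows "T = UNIV"
proof -
  have "open (- T)"
    unfolding open_contains_ball
  proof
    fix p assume p: "p \<in> - T"
    obtain x where x: "x \<in> T" "p - x \<in> \<Gamma>" using cover by blast
    obtain r where r: "0 < r" "ball x r \<subseteq> T" using \<open>open T\<close> x openE by blast
    have "ball p r \<subseteq> - T"
    proof
      fix q assume q: "q \<in> ball p r"
      have mem: "q - (p - x) \<in> T" using q r by (auto simp: dist_norm algebra_simps subset_iff)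
      show "q \<in> - T"
      proof
        assume "q \<in> T"
        then have "x + (p - x) \<in> T" using translates[OF mem x(1,2)] by simp
        then show False using p by simp
      qed
    qed
    then show "\<exists>e>0. ball p e \<subseteq> - T" using r by blast
  qed
  then have "closed T" by (simp add: closed_def)
  then show ?thesis using connected_clopen[of "UNIV :: complex set"] assms(1,2) by auto
qed

context seam_extension
begin
section \<open>The glued annulus in the coordinate of its torus\<close>

lemma annulus_class_eq_iff:
  assumes "0 < Im \<omega>" "0 \<le> Im z" "Im z \<le> Im \<omega>" "0 \<le> Im w" "Im w \<le> Im \<omega>"
  shows "annulus_class F \<omega> z = annulus_class F \<omega> w \<longleftrightarrow> z - w \<in> \<int> \<or>
      Im z = 0 \<and> w - (of_real (F (Re z)) + \<omega>) \<in> \<int> \<or> Im w = 0 \<and> z - (of_real (F (Re w)) + \<omega>) \<in> \<int>"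
proof -
  have "z \<in> closed_strip \<omega>" "w \<in> closed_strip \<omega>" using assms by (auto simp: closed_strip_def)
  then show ?thesis
    using eq_equiv_class_iff[OF equiv_annulus_rel[OF F assms(1)]]
    by (simp add: annulus_class_def) (simp add: annulus_rel_def)
qed

lemma annulus_class_eq_iff_below_top:
  assumes "0 \<le> Im z" "Im z < Im \<omega>" "0 \<le> Im w" "Im w < Im \<omega>"
  shows "annulus_class F \<omega> z = annulus_class F \<omega> w \<longleftrightarrow> z - w \<in> \<int>"
proof -
  have "w - (of_real (F (Re z)) + \<omega>) \<notin> \<int>" "z - (of_real (F (Re w)) + \<omega>) \<notin> \<int>"
    using assms Im_eq_if_diff_Ints[of w "of_real (F (Re z)) + \<omega>"] 
      Im_eq_if_diff_Ints[of z "of_real (F (Re w)) + \<omega>"] by auto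
  then show ?thesis using annulus_class_eq_iff[of \<omega> z w] assms by auto
qed

lemma annulus_class_in_points:
  assumes "0 \<le> Im z" "Im z \<le> Im \<omega>"
  shows "annulus_class F \<omega> z \<in> points (glued_annulus F \<omega>)"
  using assms by (auto simp: glued_annulus_def annulus_class_def closed_strip_def intro!: quotientI)

text \<open>Points of the upper boundary have representatives on the real axis, because \<open>F\<close> is surjective.\<close>

lemma annulus_point_below_top:
  assumes "0 < Im \<omega>" "p \<in> points (glued_annulus F \<omega>)"
  obtains z where "p = annulus_class F \<omega> z" "0 \<le> Im z" "Im z < Im \<omega>"
proof -
  obtain w where w: "p = annulus_class F \<omega> w" "0 \<le> Im w" "Im w \<le> Im \<omega>"
    using assms(2) unfolding glued_annulus_def quotient_def annulus_class_def closed_strip_def by auto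
  show ?thesis
  proof (cases "Im w < Im \<omega>")
    case True
    then show ?thesis using that w by blast
  next
    case False
    obtain x where x: "F x = Re (w - \<omega>)"
      using F unfolding analytic_circle_diffeo_def by (metis bij_pointE)
    have "w = of_real (F x) + \<omega>" using False w x by (simp add: complex_eq_iff)
    then have "p = annulus_class F \<omega> (of_real x)"
      using annulus_class_eq_iff[of \<omega> w "of_real x"] w assms(1) by simp
    then show ?thesis using that[of "of_real x"] assms(1) by simp
  qed
qed

lemma glued_annulus_params:
  assumes "(D, \<sigma>) \<in> params (glued_annulus F \<omega>)"
  shows "open D" "z \<in> D \<Longrightarrow> \<sigma> z \<in> points (glued_annulus F \<omega>)"
proof -
  show "open D" using assms by (auto simp: glued_annulus_def seam_params_def)
  assume z: "z \<in> D"
  from assms consider "D \<subseteq> {z. 0 < Im z \<and> Im z < Im \<omega>}" "\<sigma> = annulus_class F \<omega>"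
    | G' where "\<forall>z\<in>D. if 0 \<le> Im z then z \<in> {z. 0 \<le> Im z \<and> Im z < Im \<omega>} else G' z \<in> {z. - Im \<omega> < Im z \<and> Im z < 0}"
        "\<sigma> = (\<lambda>z. if 0 \<le> Im z then annulus_class F \<omega> z else annulus_class F \<omega> (G' z + \<omega>))"
    unfolding glued_annulus_def seam_params_def by auto
  then show "\<sigma> z \<in> points (glued_annulus F \<omega>)"
  proof cases
    case 1
    then show ?thesis using z by (auto intro!: annulus_class_in_points)
  next
    case 2
    then show ?thesis using z bspec[OF 2(1) z] by (auto intro!: annulus_class_in_points split: if_splits)
  qed
qed

text \<open>The open strip below height \<open>Im \<omega>\<close>, continued a little below the real axis into the top of the
  annulus.\<close>

definition across_annulus_seam :: "complex \<Rightarrow> complex \<Rightarrow> complex set" where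
  "across_annulus_seam \<omega> z = (if 0 \<le> Im z then annulus_class F \<omega> z else annulus_class F \<omega> (G z + \<omega>))"

lemma across_annulus_seam_chart:
  assumes \<omega>: "2 < Im \<omega>" and z0: "z0 \<in> strip (-e) (Im \<omega>)"
  shows "\<exists>D \<sigma>. (D, \<sigma>) \<in> params (glued_annulus F \<omega>) \<and> z0 \<in> D \<and> D \<subseteq> strip (-e) (Im \<omega>) \<and>
    (\<forall>z\<in>D. \<sigma> z = across_annulus_seam \<omega> z)"
proof (cases "0 < Im z0")
  case True
  define r where "r = min (min (Im z0) (Im \<omega> - Im z0)) (1/2)"
  have r: "r \<le> Im z0" "r \<le> Im \<omega> - Im z0" "r \<le> 1/2" "0 < r" using True z0 unfolding r_def by (auto simp: min_def)
  have inside: "0 < Im z \<and> Im z < Im \<omega>" if "z \<in> ball z0 r" for z using ball_Im[OF that] r by linarith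
  have "inj_on (annulus_class F \<omega>) (ball z0 r)"
  proof (rule inj_onI)
    fix z w assume "z \<in> ball z0 r" "w \<in> ball z0 r" "annulus_class F \<omega> z = annulus_class F \<omega> w"
    then show "z = w"
      using inside[of z] inside[of w] annulus_class_eq_iff_below_top[of z \<omega> w]
        eq_in_ball_if_diff_Ints[of z z0 r w] r by simp
  qed
  then have "(ball z0 r, annulus_class F \<omega>) \<in> params (glued_annulus F \<omega>)"
    using inside by (auto simp: glued_annulus_def)
  then show ?thesis
    using inside e_pos r
    by (intro exI[of _ "ball z0 r"] exI[of _ "annulus_class F \<omega>"])
      (fastforce simp: across_annulus_seam_def)
next
  case False
  define r where "r = min (e + Im z0) (1/2)"
  have r: "r \<le> e + Im z0" "r \<le> 1/2" unfolding r_def by linarith+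
  have z0': "- e < Im z0" "Im z0 \<le> 0" using z0 False by auto
  have neq: "annulus_class F \<omega> z \<noteq> annulus_class F \<omega> (w + \<omega>)"
    if "0 \<le> Im z" "Im z < e" "-1 < Im w" "Im w < 0" for z w
  proof
    assume "annulus_class F \<omega> z = annulus_class F \<omega> (w + \<omega>)"
    then have "z - (w + \<omega>) \<in> \<int>"
      using annulus_class_eq_iff_below_top[of z \<omega> "w + \<omega>"] that e_le_1 \<omega> by simp
    then show False using Im_eq_if_diff_Ints[of z "w + \<omega>"] that e_le_1 \<omega> by simp
  qed
  have "(ball z0 r, \<lambda>z. if 0 \<le> Im z then annulus_class F \<omega> z else annulus_class F \<omega> (G z + \<omega>))
      \<in> seam_params F {z. 0 \<le> Im z \<and> Im z < Im \<omega>} (annulus_class F \<omega>)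
         {z. - Im \<omega> < Im z \<and> Im z < 0} (\<lambda>z. annulus_class F \<omega> (z + \<omega>))"
  proof (rule ball_in_seam_params[OF z0' r])
    fix z w assume zw: "z \<in> {z. - Im \<omega> < Im z \<and> Im z < 0}" "w \<in> {z. - Im \<omega> < Im z \<and> Im z < 0}"
      "annulus_class F \<omega> (z + \<omega>) = annulus_class F \<omega> (w + \<omega>)"
    then show "z - w \<in> \<int>" using annulus_class_eq_iff_below_top[of "z + \<omega>" \<omega> "w + \<omega>"] by simp
  next
    fix z w assume "z \<in> {z. 0 \<le> Im z \<and> Im z < Im \<omega>}" "w \<in> {z. 0 \<le> Im z \<and> Im z < Im \<omega>}"
      "annulus_class F \<omega> z = annulus_class F \<omega> w"
    then show "z - w \<in> \<int>" using annulus_class_eq_iff_below_top[of z \<omega> w] by simp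
  qed (use neq e_le_1 \<omega> in auto)
  then have "(ball z0 r, across_annulus_seam \<omega>) \<in> params (glued_annulus F \<omega>)"
    by (simp add: glued_annulus_def across_annulus_seam_def[abs_def])
  moreover have "ball z0 r \<subseteq> strip (-e) (Im \<omega>)"
  proof
    fix z assume "z \<in> ball z0 r"
    then show "z \<in> strip (-e) (Im \<omega>)" using ball_Im[of z z0 r] r z0' e_le_1 \<omega> by auto
  qed
  ultimately show ?thesis
    using z0' by (intro exI[of _ "ball z0 r"] exI[of _ "across_annulus_seam \<omega>"]) (auto simp: r_def)
qed

text \<open>The gluing period \<open>g\<close> lies in the lattice of \<open>\<tau>\<close>; it generates this lattice together with \<open>1\<close>.
  Indeed, let \<open>T\<close> be the union of the translates of the image of \<open>H\<close> by \<open>\<int> + g\<int>\<close>. By injectivity on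
  the annulus two translates of \<open>T\<close> by lattice elements that meet are equal, and by surjectivity the
  translates cover the plane. So \<open>T\<close> is the whole plane, and \<open>\<tau>\<close> translates \<open>T\<close> to itself, which means
  \<open>\<tau> \<in> \<int> + g\<int>\<close>. Then \<open>g = m \<plusminus> \<tau>\<close>, and the sign is determined by the imaginary part.\<close>

lemma index_one:
  assumes H: "H holomorphic_on strip (-e) (Im \<omega>)" and \<omega>: "2 < Im \<omega>"
    and H1: "\<And>z. z \<in> strip (-e) (Im \<omega>) \<Longrightarrow> H (z + 1) = H z + 1"
    and Hg: "\<And>z. z \<in> strip (-e) 0 \<Longrightarrow> H (G z + \<omega>) = H z + g"
    and inj: "\<And>z w. 0 \<le> Im z \<Longrightarrow> Im z < Im \<omega> \<Longrightarrow> 0 \<le> Im w \<Longrightarrow> Im w < Im \<omega> \<Longrightarrow>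
        H z - H w \<in> period_lattice \<tau> \<Longrightarrow> z - w \<in> \<int>"
    and surj: "\<And>p. \<exists>z. 0 \<le> Im z \<and> Im z < Im \<omega> \<and> p - H z \<in> period_lattice \<tau>"
    and g: "g \<in> period_lattice \<tau>" "0 < Im g" and \<tau>: "0 < Im \<tau>"
  shows "g - \<tau> \<in> \<int>"
proof -
  define U where "U = strip (-e) (Im \<omega>)"
  define T where "T = (\<Union>x\<in>period_lattice g. (+) x ` H ` U)"
  have in_\<tau>: "x \<in> period_lattice \<tau>" if "x \<in> period_lattice g" for x
    using that period_lattice_subset[OF g(1)] by blast
  have Hint: "H (z + of_int k) = H z + of_int k" if "z \<in> U" for z k
    using periodic_on_strip_add_int[of "-e" "Im \<omega>" "\<lambda>z. H z - z" z k] that H1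
    by (simp add: U_def algebra_simps)
  \<comment> \<open>Injectivity is known at heights in \<open>[0, Im \<omega>)\<close>; points below the axis are moved there by the gluing.\<close>
  have reduce: "\<exists>w. 0 \<le> Im w \<and> Im w < Im \<omega> \<and> H w - H z \<in> period_lattice g" if z: "z \<in> U" for z
  proof (cases "0 \<le> Im z")
    case True
    then show ?thesis using z zero_in_period_lattice by (intro exI[of _ z]) (auto simp: U_def)
  next
    case False
    then have "H (G z + \<omega>) - H z = g" "0 \<le> Im (G z + \<omega>)" "Im (G z + \<omega>) < Im \<omega>"
      using Hg[of z] G_lower'[of z] z \<omega> by (auto simp: U_def)
    then show ?thesis using generator_in_period_lattice by metis
  qed
  have key: "H z - H w \<in> period_lattice g" 
    if zw: "z \<in> U" "w \<in> U" and d: "H z - H w \<in> period_lattice \<tau>" for z w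
  proof -
    obtain z' where z': "0 \<le> Im z'" "Im z' < Im \<omega>" "H z' - H z \<in> period_lattice g"
      using reduce[OF zw(1)] by blast
    obtain w' where w': "0 \<le> Im w'" "Im w' < Im \<omega>" "H w' - H w \<in> period_lattice g"
      using reduce[OF zw(2)] by blast
    have "(H z' - H z) + (H z - H w) - (H w' - H w) \<in> period_lattice \<tau>"
      by (rule period_lattice_diff[OF period_lattice_add[OF in_\<tau>[OF z'(3)] d] in_\<tau>[OF w'(3)]])
    then have "z' - w' \<in> \<int>" using inj[OF z'(1,2) w'(1,2)] by simp
    then obtain k where "z' = w' + of_int k" by (auto elim!: Ints_cases simp: algebra_simps)
    then have "H z' - H w' = of_int k" using Hint[of w' k] w' e_pos by (simp add: U_def)
    then have "(H z' - H w') - (H z' - H z) + (H w' - H w) \<in> period_lattice g"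
      using period_lattice_add[OF period_lattice_diff[OF of_int_in_period_lattice[of k] z'(3)] w'(3)] by simp
    then show ?thesis by simp
  qed
  have T: "x \<in> T \<longleftrightarrow> (\<exists>z\<in>U. x - H z \<in> period_lattice g)" for x
  proof
    assume "\<exists>z\<in>U. x - H z \<in> period_lattice g"
    then obtain z where "z \<in> U" "x - H z \<in> period_lattice g" by blast
    moreover have "x = (x - H z) + H z" by simp
    ultimately show "x \<in> T" unfolding T_def by blast
  next
    assume "x \<in> T"
    then obtain y z where "y \<in> period_lattice g" "z \<in> U" "x = y + H z" unfolding T_def by blast
    then show "\<exists>z\<in>U. x - H z \<in> period_lattice g" by (intro bexI[of _ z]) auto
  qed
  have "T = UNIV"
  proof (rule open_set_with_disjoint_translates[where \<Gamma> = "period_lattice \<tau>"])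
    have "open (H ` strip (-e) (Im \<omega>))"
    proof (rule open_mapping_thm[OF H open_strip _ open_strip])
      show "\<not> H constant_on strip (-e) (Im \<omega>)"
      proof
        assume "H constant_on strip (-e) (Im \<omega>)"
        then have "H 1 = H 0" using e_pos \<omega> by (auto simp: constant_on_def)
        then show False using H1[of 0] e_pos \<omega> by simp
      qed
    qed (auto intro: convex_connected convex_strip)
    then show "open T" unfolding T_def U_def by (intro open_UN ballI open_translation)
    have "H 0 \<in> T" unfolding T
      using zero_in_period_lattice e_pos \<omega> by (intro bexI[of _ 0]) (auto simp: U_def)
    then show "T \<noteq> {}" by blast
    show "\<exists>x\<in>T. p - x \<in> period_lattice \<tau>" for p
    proof -
      obtain z where z: "0 \<le> Im z" "Im z < Im \<omega>" "p - H z \<in> period_lattice \<tau>" using surj by blast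
      then have "H z \<in> T" unfolding T using zero_in_period_lattice e_pos by (intro bexI[of _ z]) (auto simp: U_def)
      then show ?thesis using z by blast
    qed
    fix x y t assume x: "x \<in> T" and y: "y \<in> T" and t: "t \<in> period_lattice \<tau>" and xt: "x + t \<in> T"
    obtain z where z: "z \<in> U" "x - H z \<in> period_lattice g" using x T by blast
    obtain w where w: "w \<in> U" "x + t - H w \<in> period_lattice g" using xt T by blast
    obtain v where v: "v \<in> U" "y - H v \<in> period_lattice g" using y T by blast
    have "(x - H z) + t - (x + t - H w) \<in> period_lattice \<tau>"
      by (rule period_lattice_diff[OF period_lattice_add[OF in_\<tau>[OF z(2)] t] in_\<tau>[OF w(2)]])
    then have wz: "H w - H z \<in> period_lattice g" using key[OF w(1) z(1)] by simp
    have "(x + t - H w) - (x - H z) + (H w - H z) + (y - H v) \<in> period_lattice g"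
      by (rule period_lattice_add[OF period_lattice_add[OF period_lattice_diff[OF w(2) z(2)] wz] v(2)])
    then show "y + t \<in> T" unfolding T using v by (intro bexI[of _ v]) (auto simp: algebra_simps)
  qed
  moreover have 0: "0 \<in> U" using e_pos \<omega> by (simp add: U_def)
  ultimately obtain w where w: "w \<in> U" "H 0 + \<tau> - H w \<in> period_lattice g" using T by blast
  have "\<tau> - (H 0 + \<tau> - H w) \<in> period_lattice \<tau>"
    by (rule period_lattice_diff[OF generator_in_period_lattice in_\<tau>[OF w(2)]])
  then have "H w - H 0 \<in> period_lattice g" using key[OF w(1) 0] by simp
  then have "(H 0 + \<tau> - H w) + (H w - H 0) \<in> period_lattice g" by (rule period_lattice_add[OF w(2)])
  then obtain a b :: int where ab: "\<tau> = of_int a + of_int b * g" unfolding period_lattice_def by auto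
  obtain m n :: int where mn: "g = of_int m + of_int n * \<tau>" using g(1) unfolding period_lattice_def by auto
  have "Im \<tau> = of_int b * Im g" "Im g = of_int n * Im \<tau>"
    by (subst ab, simp) (subst mn, simp)
  then have "of_int (b * n) * Im \<tau> = 1 * Im \<tau>" "0 < n" using g(2) \<tau> by (auto simp: zero_less_mult_iff)
  then have "b * n = 1" "0 < n" using \<tau> by (auto simp only: mult_cancel_right of_int_eq_1_iff)
  then have "n = 1" using pos_zmult_eq_1_iff[of n b] by (simp add: mult.commute)
  then show ?thesis using mn by simp
qed

text \<open>The lift of the isomorphism onto the torus. Its period under \<open>z \<mapsto> z + 1\<close> is \<open>1\<close> because of the
  homotopy between the two circles; the period under the gluing map is a lattice element that represents
  the complex rotation number once its imaginary part is known to be positive.\<close>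

lemma torus_coordinate:
  assumes \<omega>: "2 < Im \<omega>" and rot: "has_complex_rotation_number F \<omega> \<tau>"
  obtains H g where "H holomorphic_on strip (-e) (Im \<omega>)"
    "\<And>z. z \<in> strip (-e) (Im \<omega>) \<Longrightarrow> H (z + 1) = H z + 1"
    "\<And>z. z \<in> strip (-e) 0 \<Longrightarrow> H (G z + \<omega>) = H z + g"
    "\<And>z w. z \<in> strip 0 (Im \<omega>) \<Longrightarrow> w \<in> strip 0 (Im \<omega>) \<Longrightarrow> H z - H w \<in> \<int> \<Longrightarrow> z - w \<in> \<int>"
    "0 < Im g \<Longrightarrow> g - \<tau> \<in> \<int>"
proof -
  let ?c = "coset (period_lattice \<tau>)"
  define U where "U = strip (-e) (Im \<omega>)"
  obtain h where \<tau>: "0 < Im \<tau>"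
    and bi: "biholomorphic_map (glued_annulus F \<omega>) (torus \<tau>) h"
    and hom: "homotopic_with (\<lambda>\<gamma>. \<gamma> 0 = \<gamma> 1) (top_of_set {0..1 :: real}) (surface_topology (torus \<tau>))
          (\<lambda>t. h (annulus_class F \<omega> (of_real t))) (\<lambda>t. ?c (of_real t))"
    using rot unfolding has_complex_rotation_number_def by blast
  have hol: "holomorphic_map (glued_annulus F \<omega>) (torus \<tau>) h" using bi by (simp add: biholomorphic_map_def)
  have bij: "bij_betw h (points (glued_annulus F \<omega>)) (range ?c)"
    using bi by (simp add: biholomorphic_map_def torus_def)
  then have h_sub: "h ` points (glued_annulus F \<omega>) \<subseteq> range ?c" by (simp add: bij_betw_def)
  have U: "convex U" "open U" unfolding U_def by (rule convex_strip open_strip)+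
  have "\<exists>r f. 0 < r \<and> ball z0 r \<subseteq> U \<and> f holomorphic_on ball z0 r \<and>
      (\<forall>z\<in>ball z0 r. h (across_annulus_seam \<omega> z) = ?c (f z))" if z0: "z0 \<in> U" for z0
  proof -
    obtain D \<sigma> where D: "(D, \<sigma>) \<in> params (glued_annulus F \<omega>)" "z0 \<in> D" "D \<subseteq> U"
      "\<forall>z\<in>D. \<sigma> z = across_annulus_seam \<omega> z"
      using across_annulus_seam_chart[OF \<omega> z0[unfolded U_def]] unfolding U_def by blast
    have "\<exists>r f. 0 < r \<and> ball z0 r \<subseteq> D \<and> f holomorphic_on ball z0 r \<and>
      (\<forall>z\<in>ball z0 r. h (\<sigma> z) = ?c (f z))"
      by (rule torus_local_lift[OF hol \<tau> _ _ h_sub D(1,2)]) (use glued_annulus_params in blast)+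
    then obtain r f where "0 < r" "ball z0 r \<subseteq> D" "f holomorphic_on ball z0 r"
      "\<And>z. z \<in> ball z0 r \<Longrightarrow> h (\<sigma> z) = ?c (f z)" by blast
    moreover have "h (across_annulus_seam \<omega> z) = h (\<sigma> z)" if "z \<in> D" for z
      using D(4) that by simp
    ultimately show ?thesis using D(3) by (metis subset_iff)
  qed
  then obtain H where H: "H holomorphic_on U" and lift: "\<And>z. z \<in> U \<Longrightarrow> h (across_annulus_seam \<omega> z) = ?c (H z)"
    using holomorphic_lift_through_coset[OF \<tau> U, of "\<lambda>z. h (across_annulus_seam \<omega> z)"] by blast
  have cont: "continuous_on U H" using H by (rule holomorphic_on_imp_continuous_on)
  have diff: "H z - H w \<in> period_lattice \<tau>"
    if "z \<in> U" "w \<in> U" "across_annulus_seam \<omega> z = across_annulus_seam \<omega> w" for z w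
    using lift[OF that(1)] lift[OF that(2)] that(3) coset_lattice_eq_iff[of \<tau> "H z" "H w"] by simp
  have lattice_const: "\<exists>c. \<forall>z\<in>S. f z = c" 
    if "connected S" "continuous_on S f" "\<And>z. z \<in> S \<Longrightarrow> f z \<in> period_lattice \<tau>" for S and f :: "complex \<Rightarrow> complex"
    by (rule discrete_valued_constant[OF that(1,2), of "period_lattice \<tau>" "min 1 (Im \<tau>)"])
      (use that(3) \<tau> period_lattice_separated in auto)
  have per: "H (z + 1) - H z \<in> period_lattice \<tau>" if z: "z \<in> U" for z
  proof (rule diff)
    show "across_annulus_seam \<omega> (z + 1) = across_annulus_seam \<omega> z"
    proof (cases "0 \<le> Im z")
      case True
      then show ?thesis using z by (simp add: across_annulus_seam_def annulus_class_eq_iff_below_top U_def)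
    next
      case False
      moreover have "G (z + 1) = G z + 1" using G_add_int[of z 1] False z e_pos by (simp add: U_def)
      moreover have "Im (G z) < 0" "-1 < Im (G z)" using G_lower'[of z] False z by (auto simp: U_def)
      ultimately show ?thesis
        using \<omega> by (simp add: across_annulus_seam_def annulus_class_eq_iff_below_top)
    qed
  qed (use z in \<open>auto simp: U_def\<close>)
  have "continuous_on U (\<lambda>z. H (z + 1) - H z)"
    by (rule continuous_on_translation_difference[OF cont]) (simp add: U_def)
  then have "\<exists>c. \<forall>z\<in>U. H (z + 1) - H z = c"
    by (rule lattice_const[OF convex_connected[OF U(1)]]) (rule per)
  then obtain l where l: "\<And>z. z \<in> U \<Longrightarrow> H (z + 1) - H z = l"
    by blast
  have real_U: "of_real t \<in> U" for t using e_pos \<omega> by (simp add: U_def)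
  have "H (of_real 1) - H (of_real 0) = 1"
  proof (rule torus_loop_period[OF \<tau>, of "\<lambda>t. H (of_real t)"])
    show "continuous_on {0..1} (\<lambda>t. H (of_real t))"
      by (rule continuous_on_compose2[OF cont]) (use real_U in \<open>auto intro!: continuous_intros\<close>)
    have "h (annulus_class F \<omega> (of_real t)) = ?c (H (of_real t))" for t
      using lift[OF real_U[of t]] by (simp add: across_annulus_seam_def)
    then show "homotopic_with (\<lambda>\<gamma>. \<gamma> 0 = \<gamma> 1) (top_of_set {0..1 :: real}) (surface_topology (torus \<tau>))
          (\<lambda>t. ?c (H (of_real t))) (\<lambda>t. ?c (of_real t))"
      using hom by simp
  qed
  then have H1: "H (z + 1) = H z + 1" if "z \<in> U" for z
    using l[OF that] l[OF real_U[of 0]] by (simp add: algebra_simps)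
  have NU: "z \<in> U" "G z + \<omega> \<in> U" "0 \<le> Im (G z + \<omega>)" if "z \<in> strip (-e) 0" for z
    using that G_lower'[of z] \<omega> e_pos by (auto simp: U_def)
  have seam: "H (G z + \<omega>) - H z \<in> period_lattice \<tau>" if z: "z \<in> strip (-e) 0" for z
    using z NU[OF z] by (intro diff) (auto simp: across_annulus_seam_def)
  have "continuous_on (strip (-e) 0) (\<lambda>z. H (G z + \<omega>) - H z)"
  proof (rule continuous_on_diff)
    have "continuous_on (strip (-e) 0) G"
      by (rule continuous_on_subset[OF holomorphic_on_imp_continuous_on[OF G_holomorphic]]) (use e_pos in auto)
    then show "continuous_on (strip (-e) 0) (\<lambda>z. H (G z + \<omega>))"
      by (intro continuous_on_compose2[OF cont] continuous_intros) (use NU in auto)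
    show "continuous_on (strip (-e) 0) H" by (rule continuous_on_subset[OF cont]) (use NU in auto)
  qed
  then have "\<exists>c. \<forall>z\<in>strip (-e) 0. H (G z + \<omega>) - H z = c"
    by (rule lattice_const[OF convex_connected[OF convex_strip]]) (rule seam)
  then obtain g where g: "\<And>z. z \<in> strip (-e) 0 \<Longrightarrow> H (G z + \<omega>) - H z = g"
    by blast
  have g_lattice: "g \<in> period_lattice \<tau>"
  proof -
    have "- (of_real (e/2) * \<i>) \<in> strip (-e) 0" using e_pos by simp
    then show ?thesis using g seam by metis
  qed
  have Hg: "H (G z + \<omega>) = H z + g" if "z \<in> strip (-e) 0" for z
    using g[OF that] by (simp add: algebra_simps)
  have inj: "z - w \<in> \<int>"
    if zw: "0 \<le> Im z" "Im z < Im \<omega>" "0 \<le> Im w" "Im w < Im \<omega>" and d: "H z - H w \<in> period_lattice \<tau>" for z w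
  proof -
    have "h (annulus_class F \<omega> z) = h (annulus_class F \<omega> w)"
      using lift[of z] lift[of w] zw d e_pos coset_lattice_eq_iff[of \<tau> "H z" "H w"]
      by (simp add: U_def across_annulus_seam_def)
    then have "annulus_class F \<omega> z = annulus_class F \<omega> w"
      using inj_onD[OF bij_betw_imp_inj_on[OF bij]] annulus_class_in_points zw by (meson less_imp_le)
    then show ?thesis using annulus_class_eq_iff_below_top zw by blast
  qed
  have surj: "\<exists>z. 0 \<le> Im z \<and> Im z < Im \<omega> \<and> p - H z \<in> period_lattice \<tau>" for p
  proof -
    obtain q where q: "q \<in> points (glued_annulus F \<omega>)" "?c p = h q"
      using bij unfolding bij_betw_def by (metis imageE rangeI)
    obtain z where z: "q = annulus_class F \<omega> z" "0 \<le> Im z" "Im z < Im \<omega>"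
      using annulus_point_below_top[OF _ q(1)] \<omega> by auto
    then have "?c p = ?c (H z)"
      using q lift[of z] e_pos by (simp add: U_def across_annulus_seam_def)
    then show ?thesis using z by (auto simp: coset_lattice_eq_iff)
  qed
  show ?thesis
  proof (rule that[of H g])
    show "H holomorphic_on strip (-e) (Im \<omega>)" using H by (simp add: U_def)
    show "H (z + 1) = H z + 1" if "z \<in> strip (-e) (Im \<omega>)" for z using that H1 by (simp add: U_def)
    show "H (G z + \<omega>) = H z + g" if "z \<in> strip (-e) 0" for z by (rule Hg[OF that])
    show "z - w \<in> \<int>" if "z \<in> strip 0 (Im \<omega>)" "w \<in> strip 0 (Im \<omega>)" "H z - H w \<in> \<int>" for z w
      using inj[of z w] that Ints_subset_period_lattice by auto
    show "g - \<tau> \<in> \<int>" if "0 < Im g"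
      by (rule index_one[OF H[unfolded U_def] \<omega> H1[unfolded U_def] Hg inj surj g_lattice that \<tau>])
  qed
qed

end
section \<open>The limit of the complex rotation number\<close>

theorem theorem20:
  fixes F :: "real \<Rightarrow> real" and \<tau> :: "complex \<Rightarrow> complex" and C :: complex
  assumes "analytic_circle_diffeo F"
    and "has_welding_constant F C"
    and "\<And>\<omega>. 0 < Im \<omega> \<Longrightarrow> has_complex_rotation_number F \<omega> (\<tau> \<omega>)"
  shows "tends_to_0_mod_Ints (\<lambda>\<omega>. \<tau> \<omega> - \<omega> - C) (filtercomap Im at_top)"
proof -
  obtain e G where "0 < e" "e \<le> 1" "G holomorphic_on strip (-e) e" "inj_on G (strip (-e) e)"
    "\<And>x. G (of_real x) = of_real (F x)"
    "\<And>z k. z \<in> strip (-e) e \<Longrightarrow> G (z + of_int k) = G z + of_int k"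
    "\<And>z. z \<in> strip (-e) 0 \<Longrightarrow> G z \<in> strip (-1) 0"
    using circle_diffeo_univalent_extension[OF assms(1)] by blast
  then interpret seam_extension F e G
    using assms(1) by unfold_locales
  obtain \<Phi>p \<Phi>m A B where
    p: "\<Phi>p holomorphic_on {z. -e < Im z}" and m: "\<Phi>m holomorphic_on {z. Im z < 0}" and
    p1: "\<And>z. -e < Im z \<Longrightarrow> \<Phi>p (z + 1) = \<Phi>p z + 1" and m1: "\<And>z. Im z < 0 \<Longrightarrow> \<Phi>m (z + 1) = \<Phi>m z + 1" and
    pm: "\<And>z. z \<in> strip (-e) 0 \<Longrightarrow> \<Phi>m (G z) = \<Phi>p z" and
    limp: "((\<lambda>z. \<Phi>p z - z) \<longlongrightarrow> A) (filtercomap Im at_top)" and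
    limm: "((\<lambda>z. \<Phi>m z - z) \<longlongrightarrow> B) (filtercomap Im at_bot)" and
    AB: "C - (A - B) \<in> \<int>"
    by (rule welding_maps[OF assms(2)]) blast
  define K where "K = 2 * coordinate_oscillation_bound + 2"
  have K: "0 < K" unfolding K_def coordinate_oscillation_bound_def by (intro add_nonneg_pos) auto
  show ?thesis
    unfolding tends_to_0_mod_Ints_def
  proof (rule tendstoI)
    fix \<epsilon> :: real assume \<epsilon>: "0 < \<epsilon>"
    \<comment> \<open>Besides accuracy \<open>\<epsilon>\<close>, accuracy \<open>1\<close> is needed to make \<open>Im g\<close> positive.\<close>
    define d where "d = min 1 \<epsilon> / (2 * K)"
    have d: "0 < d" "K * d < \<epsilon>" "K * d < 1" using \<epsilon> K by (auto simp: d_def)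
    obtain R where R: "\<forall>z\<in>{z. R < Im z}. dist (\<Phi>p z - z) A < d"
      using tendstoD[OF limp d(1)] unfolding eventually_Im_at_top by blast
    obtain R' where R': "\<forall>z\<in>{z. Im z < R'}. dist (\<Phi>m z - z) B < d"
      using tendstoD[OF limm d(1)] unfolding eventually_Im_at_bot by blast
    have near_p: "norm (\<Phi>p z - z - A) \<le> d" if "R < Im z" for z
      using R that by (auto simp: dist_norm less_imp_le)
    have near_m: "norm (\<Phi>m z - z - B) \<le> d" if "Im z < R'" for z
      using R' that by (auto simp: dist_norm less_imp_le)
    \<comment> \<open>Unit discs about the points of height \<open>\<plusminus>Im \<omega> / 2\<close> must lie in the regions of good approximation.\<close>
    define M where "M = 2 * (\<bar>R\<bar> + \<bar>R'\<bar> + 2) + 2 + norm (A - B)"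
    have "infdist (\<tau> \<omega> - \<omega> - C) \<int> < \<epsilon>" if "M < Im \<omega>" for \<omega>
    proof -
      have big: "2 < Im \<omega>" "R < Im \<omega> / 2 - 1" "- Im \<omega> / 2 + 1 < R'" "1 < Im \<omega> / 2" "norm (A - B) + 1 < Im \<omega>"
        using that[unfolded M_def] norm_ge_zero[of "A - B"] abs_ge_zero[of R] abs_ge_zero[of R']
          abs_ge_self[of R] abs_ge_minus_self[of R'] by argo+
      obtain H g where H: "H holomorphic_on strip (-e) (Im \<omega>)"
        "\<And>z. z \<in> strip (-e) (Im \<omega>) \<Longrightarrow> H (z + 1) = H z + 1"
        "\<And>z. z \<in> strip (-e) 0 \<Longrightarrow> H (G z + \<omega>) = H z + g"
        "\<And>z w. z \<in> strip 0 (Im \<omega>) \<Longrightarrow> w \<in> strip 0 (Im \<omega>) \<Longrightarrow> H z - H w \<in> \<int> \<Longrightarrow> z - w \<in> \<int>"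
        and index: "0 < Im g \<Longrightarrow> g - \<tau> \<omega> \<in> \<int>"
        using torus_coordinate[OF big(1) assms(3)] big by (smt (verit))
      have Im_near: "\<bar>Im w - Im z\<bar> \<le> 1" if "w \<in> cball z 1" for w z :: complex
        using that abs_Im_le_cmod[of "z - w"] by (auto simp: dist_norm abs_minus_commute)
      have dp: "norm (deriv \<Phi>p z - 1) \<le> d" if "Im z = Im \<omega> / 2" for z
      proof (rule deriv_near_1_if_near_translation[OF p open_halfspace_Im_gt])
        show "cball z 1 \<subseteq> {z. -e < Im z}" using Im_near that big e_pos by (fastforce simp: abs_le_iff)
        show "norm (\<Phi>p w - w - A) \<le> d" if "w \<in> cball z 1" for w
          using Im_near[OF that] \<open>Im z = Im \<omega> / 2\<close> big by (intro near_p) (auto simp: abs_le_iff)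
      qed
      have dm: "norm (deriv \<Phi>m z - 1) \<le> d" if "Im z = - Im \<omega> / 2" for z
      proof (rule deriv_near_1_if_near_translation[OF m open_halfspace_Im_lt])
        show "cball z 1 \<subseteq> {z. Im z < 0}" using Im_near that big by (fastforce simp: abs_le_iff)
        show "norm (\<Phi>m w - w - B) \<le> d" if "w \<in> cball z 1" for w
          using Im_near[OF that] \<open>Im z = - Im \<omega> / 2\<close> big by (intro near_m) (auto simp: abs_le_iff)
      qed
      have G1: "G (z + 1) = G z + 1" if "z \<in> strip (-e) e" for z using G_add_int[OF that, of 1] by simp
      define z where "z = \<omega> / 2"
      have z: "Im z = Im \<omega> / 2" by (simp add: z_def)
      have "norm (\<Phi>p z - \<Phi>m (z - \<omega>) - g) \<le> 2 * coordinate_oscillation_bound * d"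
        by (rule gluing_period_estimate[OF e_pos big(1) H(1) p m G_holomorphic G_lower H(2) p1 m1 G1 pm H(3,4) dp dm z])
      moreover have "norm (\<Phi>p z - z - A) \<le> d" "norm (\<Phi>m (z - \<omega>) - (z - \<omega>) - B) \<le> d"
        using big z by (auto intro!: near_p near_m)
      moreover have "g - (\<omega> + A - B) = (\<Phi>p z - z - A) - (\<Phi>m (z - \<omega>) - (z - \<omega>) - B) - (\<Phi>p z - \<Phi>m (z - \<omega>) - g)"
        by simp
      ultimately have est: "norm (g - (\<omega> + A - B)) \<le> K * d"
        using norm_triangle_ineq4[of "(\<Phi>p z - z - A) - (\<Phi>m (z - \<omega>) - (z - \<omega>) - B)" "\<Phi>p z - \<Phi>m (z - \<omega>) - g"]
          norm_triangle_ineq4[of "\<Phi>p z - z - A" "\<Phi>m (z - \<omega>) - (z - \<omega>) - B"]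
        by (simp add: K_def algebra_simps)
      have "\<bar>Im (g - (\<omega> + A - B))\<bar> < 1" "\<bar>Im (A - B)\<bar> \<le> norm (A - B)"
        using est d abs_Im_le_cmod[of "g - (\<omega> + A - B)"] abs_Im_le_cmod[of "A - B"] by linarith+
      then have "0 < Im g" using big(5) by (auto simp: abs_le_iff abs_less_iff)
      then have "g - \<tau> \<omega> \<in> \<int>" by (rule index)
      then have "(C - (A - B)) + (g - \<tau> \<omega>) \<in> \<int>" using AB by (intro Ints_add)
      then have "(g - (\<omega> + A - B)) - (\<tau> \<omega> - \<omega> - C) \<in> \<int>" by (simp add: algebra_simps)
      from infdist_Ints_cong[OF this] have "infdist (\<tau> \<omega> - \<omega> - C) \<int> \<le> norm (g - (\<omega> + A - B))"
        using infdist_Ints_le[of 0 "g - (\<omega> + A - B)"] by simp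
      then show ?thesis using est d by linarith
    qed
    then have "eventually (\<lambda>\<omega>. infdist (\<tau> \<omega> - \<omega> - C) \<int> < \<epsilon>) (filtercomap Im at_top)"
      unfolding eventually_Im_at_top by blast
    then show "eventually (\<lambda>\<omega>. dist (infdist (\<tau> \<omega> - \<omega> - C) \<int>) 0 < \<epsilon>) (filtercomap Im at_top)"
      by (simp add: infdist_nonneg)
  qed
qed

end
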